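(* If $m>1$ is real, then $R\mapsto\lambda_m(R)$ is nonincreasing on $(0,\infty)$.
   Context: For real $m\ge1$ and $R>0$ put $w_m(r)=r^m e^{-r^2/2}$, $W_{m,R}=\int_0^R w_m(r)\,dr$, and let $\mu_{m,R}$ be the probability measure $d\mu_{m,R}(r)=\frac{w_m(r)}{W_{m,R}}\,dr$ on $(0,R)$. Write $\mathbb E_{m,R}\phi=\int_0^R\phi\,d\mu_{m,R}$ and $\mathrm{Var}_{m,R}(\phi)=\mathbb E_{m,R}[(\phi-\mathbb E_{m,R}\phi)^2]$. The space $H^1((0,R),w_m\,dr)$ consists of the real functions $v\in H^1_{\mathrm{loc}}((0,R))$ with $\int_0^R(v^2+v'^2)w_m\,dr<\infty$. For such $v$ set $(Tv)(r)=rv(r)-v'(r)$. For $g\in L^2((0,R),w_m\,dr)$ with $\mathbb E_{m,R}g=1$ and $v\in H^1((0,R),w_m\,dr)$ define $$\Phi_{m,R}(g,v)=\mathbb E_{m,R}\Big[v'^2+v^2+\frac{(g+Tv)^2}{m}\Big]-\mathrm{Var}_{m,R}(g),\qquad \lambda_m(R)=\sup_{\substack{g\in L^2((0,R),w_m\,dr)\\ \mathbb E_{m,R}g=1}}\ \inf_{v\in H^1((0,R),w_m\,dr)}\Phi_{m,R}(g,v).$$ *)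

theory Defs
  imports "HOL-Analysis.Analysis"
begin

abbreviation leb_ivl :: "real \<Rightarrow> real measure" where
  "leb_ivl R \<equiv> restrict_space lborel {0<..<R}"

definition L2 :: "real measure \<Rightarrow> (real \<Rightarrow> real) set" where
  "L2 M = {f \<in> borel_measurable M. integrable M (\<lambda>x. (f x)\<^sup>2)}"

definition L1_loc :: "real \<Rightarrow> (real \<Rightarrow> real) set" where
  "L1_loc R = {f. \<forall>K. compact K \<longrightarrow> K \<subseteq> {0<..<R} \<longrightarrow> integrable (restrict_space lborel K) f}"

definition L2_loc :: "real \<Rightarrow> (real \<Rightarrow> real) set" where
  "L2_loc R = {f. \<forall>K. compact K \<longrightarrow> K \<subseteq> {0<..<R} \<longrightarrow> f \<in> L2 (restrict_space lborel K)}"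

definition test_functions :: "real \<Rightarrow> (real \<Rightarrow> real) set" where
  "test_functions R = {\<phi>. (\<forall>n x. ((deriv ^^ n) \<phi>) differentiable (at x)) \<and>
     (\<exists>K. compact K \<and> K \<subseteq> {0<..<R} \<and> (\<forall>x. x \<notin> K \<longrightarrow> \<phi> x = 0))}"

definition is_weak_deriv :: "real \<Rightarrow> (real \<Rightarrow> real) \<Rightarrow> (real \<Rightarrow> real) \<Rightarrow> bool" where
  "is_weak_deriv R v u \<longleftrightarrow> v \<in> L1_loc R \<and> u \<in> L1_loc R \<and>
     (\<forall>\<phi>\<in>test_functions R.
        (\<integral>r. v r * deriv \<phi> r \<partial>leb_ivl R) = - (\<integral>r. u r * \<phi> r \<partial>leb_ivl R))"

text \<open>Functions are representatives of their almost-everywhere classes, and only their values on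
  \<open>(0,R)\<close> matter. The weak derivative is determined up to null sets on \<open>(0,R)\<close>, so the
  choice made here affects none of the integrals below.\<close>

definition wderiv :: "real \<Rightarrow> (real \<Rightarrow> real) \<Rightarrow> real \<Rightarrow> real" where
  "wderiv R v = (SOME u. is_weak_deriv R v u)"

definition H1_loc :: "real \<Rightarrow> (real \<Rightarrow> real) set" where
  "H1_loc R = {v \<in> L2_loc R. \<exists>u\<in>L2_loc R. is_weak_deriv R v u}"

definition w :: "real \<Rightarrow> real \<Rightarrow> real" where
  "w m r = r powr m * exp (- r\<^sup>2 / 2)"

definition W :: "real \<Rightarrow> real \<Rightarrow> real" where
  "W m R = (\<integral>r. w m r \<partial>leb_ivl R)"

definition w_measure :: "real \<Rightarrow> real \<Rightarrow> real measure" where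
  "w_measure m R = density (leb_ivl R) (\<lambda>r. ennreal (w m r))"

definition mu :: "real \<Rightarrow> real \<Rightarrow> real measure" where
  "mu m R = density (leb_ivl R) (\<lambda>r. ennreal (w m r / W m R))"

definition Expec :: "real \<Rightarrow> real \<Rightarrow> (real \<Rightarrow> real) \<Rightarrow> real" where
  "Expec m R \<phi> = (\<integral>r. \<phi> r \<partial>mu m R)"

definition Var :: "real \<Rightarrow> real \<Rightarrow> (real \<Rightarrow> real) \<Rightarrow> real" where
  "Var m R \<phi> = Expec m R (\<lambda>r. (\<phi> r - Expec m R \<phi>)\<^sup>2)"

definition H1 :: "real \<Rightarrow> real \<Rightarrow> (real \<Rightarrow> real) set" where
  "H1 m R = {v \<in> H1_loc R. integrable (w_measure m R) (\<lambda>r. (v r)\<^sup>2 + (wderiv R v r)\<^sup>2)}"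

definition T :: "real \<Rightarrow> (real \<Rightarrow> real) \<Rightarrow> real \<Rightarrow> real" where
  "T R v r = r * v r - wderiv R v r"

definition Phi :: "real \<Rightarrow> real \<Rightarrow> (real \<Rightarrow> real) \<Rightarrow> (real \<Rightarrow> real) \<Rightarrow> real" where
  "Phi m R g v =
     Expec m R (\<lambda>r. (wderiv R v r)\<^sup>2 + (v r)\<^sup>2 + (g r + T R v r)\<^sup>2 / m) - Var m R g"

text \<open>For \<open>m \<ge> 1\<close> and \<open>R > 0\<close> the real-valued infimum and supremum are the true ones:
  \<open>Phi m R g v \<ge> - Var m R g\<close>, and taking \<open>v = 0\<close> bounds every infimum by
  \<open>1/m - (1 - 1/m) * Var m R g \<le> 1/m\<close>; the index sets contain \<open>v = 0\<close> and \<open>g = 1\<close>.\<close>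

definition lam :: "real \<Rightarrow> real \<Rightarrow> real" where
  "lam m R = (SUP g\<in>{g \<in> L2 (w_measure m R). Expec m R g = 1}. INF v\<in>H1 m R. Phi m R g v)"

end

theory Submission
  imports Defs
begin

text \<open>Throughout, \<open>Tv = r v - v'\<close>, \<open>E\<close> is the expectation for \<open>mu m R\<close>, \<open>W\<close> is the primitive of the
  weight \<open>w\<close> and \<open>X\<close> that of \<open>r^(m-1) exp(-r^2/2) = w(r)/r\<close>.

  The functional is convex in \<open>v\<close> and concave in \<open>g\<close>, and the supremum over \<open>g\<close> for a fixed \<open>v\<close> is
  explicit. Removing the constraint \<open>E g = 1\<close> with a Lagrange multiplier turns the saddle value into
  \<open>lam = N / (1 + N)\<close>, where \<open>N(R)\<close> is the minimum over \<open>v\<close> of the local energy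
  \<open>E[v'^2 + v^2 + (1 + Tv)^2 / (m-1)]\<close>. As \<open>x / (1+x)\<close> increases, \<open>N\<close> has to be nonincreasing.

  With \<open>s = (1 + Tv) / (m-1)\<close> the Euler equation reads \<open>((v' - s) w)' = (v + r s) w\<close>, with natural boundary
  condition \<open>v' = s\<close> at \<open>R\<close>. It integrates once to \<open>r s = v + c\<close> and then to \<open>s = (X - c W) / w\<close>; so the
  bounded solutions form a one-parameter family that does not depend on \<open>R\<close>, and \<open>R\<close> only selects
  the constant \<open>c = c(R)\<close>. Along the minimizer \<open>N(R) = E s\<close>.

  Since \<open>c(R)\<close> minimizes, moving \<open>R\<close> changes \<open>N W\<close> at the rate \<open>w\<close> times the energy density at the
  endpoint, which equals \<open>s + v (v + R s)\<close> there. So \<open>N\<close> decreases as soon as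
  \<open>v(R) \<le> 0 \<le> v(R) + R s(R)\<close> and \<open>s(R) \<le> E s\<close>. The two signs follow by integrating elementary derivatives from
  \<open>0\<close>. The second of them also says that \<open>c\<close> is nondecreasing in \<open>R\<close>; because \<open>r w s'\<close> is a positive
  multiple of \<open>c(r) - c(R)\<close>, this makes \<open>s\<close> nonincreasing on \<open>(0,R)\<close>, which is the third inequality
  (\<open>min_value_antimono\<close>).

  The value of \<open>lam\<close> is found by testing with these explicit functions (\<open>lam_eq\<close>). For the upper bound a multiple of the
  minimizer is tested against every \<open>g\<close> (\<open>INF_Phi_le\<close>). For the lower bound the function
  \<open>g = (1 + s) / (1 + N)\<close> is tested against every \<open>v\<close> (\<open>Phi_ge_extremal\<close>), which uses the Euler equation in weak
  form against arbitrary \<open>v\<close> in the weighted Sobolev space (\<open>euler_lagrange\<close>). That in turn rests on an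
  integration by parts for weak derivatives whose boundary terms vanish because \<open>(v' - s) w\<close> is
  small at both endpoints (\<open>weak_integration_by_parts\<close>).\<close>

section \<open>Smooth functions and cutoffs\<close>

text \<open>An inductive form of \<open>n\<close>-fold differentiability. Any derivative on \<open>S\<close> may be exhibited, so that products and
  solutions of differential equations are handled by induction on \<open>n\<close> without computing
  iterates of \<open>deriv\<close>.\<close>

fun diffs_on :: "nat \<Rightarrow> real set \<Rightarrow> (real \<Rightarrow> real) \<Rightarrow> bool" where
  "diffs_on 0 S f = True"
| "diffs_on (Suc n) S f \<longleftrightarrow>
     (\<exists>f'. (\<forall>x\<in>S. (f has_real_derivative f' x) (at x)) \<and> diffs_on n S f')"

lemma diffs_on_cong:
  assumes "open S" "\<And>x. x \<in> S \<Longrightarrow> f x = g x" "diffs_on n S f"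
  shows "diffs_on n S g"
proof (cases n)
  case (Suc k)
  with assms(3) obtain f' where f': "\<forall>x\<in>S. (f has_real_derivative f' x) (at x)" "diffs_on k S f'"
    by auto
  have "(g has_real_derivative f' x) (at x)" if "x \<in> S" for x
    by (rule has_field_derivative_transform_within_open[OF _ assms(1) that assms(2)])
       (use f'(1) that in auto)
  with f'(2) Suc show ?thesis by auto
qed simp

lemma diffs_on_SucD: "diffs_on (Suc n) S f \<Longrightarrow> diffs_on n S f"
  by (induction n arbitrary: f) auto

lemma diffs_on_Suc_I:
  "(\<And>x. x \<in> S \<Longrightarrow> (f has_real_derivative f' x) (at x)) \<Longrightarrow> diffs_on n S f' \<Longrightarrow> diffs_on (Suc n) S f"
  by auto

lemma diffs_on_const: "diffs_on n S (\<lambda>x. c)"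
  by (induction n arbitrary: c) (auto intro!: exI[of _ "\<lambda>x. 0"])

lemma diffs_on_ident: "diffs_on n S (\<lambda>x. x)"
  by (cases n) (auto intro!: exI[of _ "\<lambda>x. 1"] diffs_on_const)

lemma diffs_on_add: "diffs_on n S f \<Longrightarrow> diffs_on n S g \<Longrightarrow> diffs_on n S (\<lambda>x. f x + g x)"
proof (induction n arbitrary: f g)
  case (Suc n)
  then obtain f' g' where "\<forall>x\<in>S. (f has_real_derivative f' x) (at x)" "diffs_on n S f'"
    "\<forall>x\<in>S. (g has_real_derivative g' x) (at x)" "diffs_on n S g'" by auto
  with Suc.IH show ?case
    by (auto intro!: exI[of _ "\<lambda>x. f' x + g' x"] derivative_eq_intros)
qed simp

lemma diffs_on_mult: "diffs_on n S f \<Longrightarrow> diffs_on n S g \<Longrightarrow> diffs_on n S (\<lambda>x. f x * g x)"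
proof (induction n arbitrary: f g)
  case (Suc n)
  then obtain f' g' where fg: "\<forall>x\<in>S. (f has_real_derivative f' x) (at x)" "diffs_on n S f'"
    "\<forall>x\<in>S. (g has_real_derivative g' x) (at x)" "diffs_on n S g'" by auto
  show ?case
  proof (rule diffs_on_Suc_I)
    show "((\<lambda>x. f x * g x) has_real_derivative f x * g' x + f' x * g x) (at x)" if "x \<in> S" for x
      using fg that by (auto intro!: derivative_eq_intros)
    show "diffs_on n S (\<lambda>x. f x * g' x + f' x * g x)"
      using Suc.IH fg Suc.prems diffs_on_SucD by (intro diffs_on_add) blast+
  qed
qed simp

lemma diffs_on_diff: "diffs_on n S f \<Longrightarrow> diffs_on n S g \<Longrightarrow> diffs_on n S (\<lambda>x. f x - g x)"
  using diffs_on_add[of n S f "\<lambda>x. (-1) * g x"] diffs_on_mult[OF diffs_on_const[of n S "-1"]] by simp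

lemma diffs_on_affine: "diffs_on n UNIV f \<Longrightarrow> diffs_on n UNIV (\<lambda>x. f (a * x + b))"
proof (induction n arbitrary: f)
  case (Suc n)
  then obtain f' where f': "\<And>x. (f has_real_derivative f' x) (at x)" "diffs_on n UNIV f'" by auto
  show ?case
  proof (rule diffs_on_Suc_I)
    show "((\<lambda>x. f (a * x + b)) has_real_derivative f' (a * x + b) * a) (at x)" for x
      by (rule DERIV_chain2[OF f'(1)]) (auto intro!: derivative_eq_intros)
    show "diffs_on n UNIV (\<lambda>x. f' (a * x + b) * a)"
      by (intro diffs_on_mult diffs_on_const Suc.IH f')
  qed
qed simp

lemma diffs_on_subset: "diffs_on n S f \<Longrightarrow> S' \<subseteq> S \<Longrightarrow> diffs_on n S' f"
proof (induction n arbitrary: f)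
  case (Suc n)
  then obtain f' where "\<forall>x\<in>S. (f has_real_derivative f' x) (at x)" "diffs_on n S' f'" by auto
  with Suc.prems show ?case by (intro diffs_on_Suc_I[of S' f f']) auto
qed simp

text \<open>Used to glue a product of a cutoff with a function that is smooth only on an interval to the zero
  function outside.\<close>

lemma diffs_on_Un: "open S \<Longrightarrow> open U \<Longrightarrow> diffs_on n S f \<Longrightarrow> diffs_on n U f \<Longrightarrow> diffs_on n (S \<union> U) f"
proof (induction n arbitrary: f)
  case (Suc n)
  then obtain f1 f2 where f: "\<forall>x\<in>S. (f has_real_derivative f1 x) (at x)" "diffs_on n S f1"
    "\<forall>x\<in>U. (f has_real_derivative f2 x) (at x)" "diffs_on n U f2" by auto
  show ?case
  proof (rule diffs_on_Suc_I)
    show "(f has_real_derivative deriv f x) (at x)" if "x \<in> S \<union> U" for x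
      using that f DERIV_imp_deriv[of f] by auto
    have "diffs_on n S (deriv f)" "diffs_on n U (deriv f)"
      using diffs_on_cong[of S f1 "deriv f" n] diffs_on_cong[of U f2 "deriv f" n] f
        DERIV_imp_deriv Suc.prems by (metis)+
    then show "diffs_on n (S \<union> U) (deriv f)" using Suc by blast
  qed
qed simp

lemma diffs_on_funpow_deriv:
  assumes "open S" "diffs_on (Suc n) S f" "x \<in> S"
  shows "(deriv ^^ n) f differentiable (at x)"
  using assms(2)
proof (induction n arbitrary: f)
  case 0
  then show ?case using assms(3) by (auto simp: real_differentiable_def)
next
  case (Suc n)
  then obtain f' where f': "\<forall>x\<in>S. (f has_real_derivative f' x) (at x)" "diffs_on (Suc n) S f'" by auto
  have "diffs_on (Suc n) S (deriv f)"
    using diffs_on_cong[OF assms(1) _ f'(2), of "deriv f"] f'(1) DERIV_imp_deriv by metis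
  then have "(deriv ^^ n) (deriv f) differentiable at x" by (rule Suc.IH)
  then show ?case by (simp add: funpow_swap1)
qed

text \<open>The derivatives of \<open>exp (-1/x)\<close> are \<open>Q (1/x) exp (-1/x)\<close> with polynomials \<open>Q\<close>; carrying
  \<open>Q\<close> along makes the family closed under differentiation.\<close>

definition flat :: "real poly \<Rightarrow> real \<Rightarrow> real" where
  "flat Q x = (if x > 0 then poly Q (1 / x) * exp (- (1 / x)) else 0)"

lemma poly_times_exp_minus_tendsto_0: "((\<lambda>x. poly Q x * exp (- x)) \<longlongrightarrow> (0::real)) at_top"
proof -
  have "((\<lambda>x. \<Sum>i\<le>degree Q. coeff Q i * (x ^ i / exp x)) \<longlongrightarrow> (\<Sum>i\<le>degree Q. coeff Q i * 0)) at_top"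
    by (intro tendsto_intros tendsto_power_div_exp_0)
  moreover have "(\<lambda>x. \<Sum>i\<le>degree Q. coeff Q i * (x ^ i / exp x)) = (\<lambda>x. poly Q x * exp (- x))"
    by (simp add: poly_altdef sum_distrib_right exp_minus divide_inverse mult.assoc)
  ultimately show ?thesis by simp
qed

lemma flat_deriv:
  "(flat Q has_real_derivative flat (pCons 0 (pCons 0 (Q - pderiv Q))) x) (at x)"
proof -
  consider "x > 0" | "x < 0" | "x = 0" by linarith
  then show ?thesis
  proof cases
    case 1
    have "((\<lambda>x. poly Q (1 / x) * exp (- (1 / x))) has_real_derivative
        flat (pCons 0 (pCons 0 (Q - pderiv Q))) x) (at x)"
      using 1 by (auto intro!: derivative_eq_intros simp: flat_def field_simps power2_eq_square)
    then show ?thesis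
      by (rule has_field_derivative_transform_within_open[where S = "{0<..}"])
         (use 1 in \<open>auto simp: flat_def\<close>)
  next
    case 2
    have "((\<lambda>x. 0) has_real_derivative flat (pCons 0 (pCons 0 (Q - pderiv Q))) x) (at x)"
      using 2 by (auto simp: flat_def)
    then show ?thesis
      by (rule has_field_derivative_transform_within_open[where S = "{..<0}"])
         (use 2 in \<open>auto simp: flat_def\<close>)
  next
    case 3
    \<comment> \<open>At the origin the difference quotient is itself a member of the family, with \<open>x Q\<close> for \<open>Q\<close>.\<close>
    have "((\<lambda>h. poly (pCons 0 Q) (inverse h) * exp (- (inverse h))) \<longlongrightarrow> 0) (at_right 0)"
      by (rule filterlim_compose[OF poly_times_exp_minus_tendsto_0 filterlim_inverse_at_top_right])
    then have "((\<lambda>h. (flat Q (0 + h) - flat Q 0) / h) \<longlongrightarrow> 0) (at_right 0)"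
      by (rule Lim_transform_eventually)
         (auto simp: flat_def eventually_at_filter field_simps)
    moreover have "((\<lambda>h. (flat Q (0 + h) - flat Q 0) / h) \<longlongrightarrow> 0) (at_left 0)"
      by (rule Lim_transform_eventually[OF tendsto_const])
         (auto simp: flat_def eventually_at_filter)
    ultimately show ?thesis
      using 3 by (auto simp: DERIV_def flat_def filterlim_split_at)
  qed
qed

lemma diffs_on_flat: "diffs_on n UNIV (flat Q)"
proof (induction n arbitrary: Q)
  case (Suc n)
  show ?case by (rule diffs_on_Suc_I[OF flat_deriv Suc])
qed simp

abbreviation bump :: "real \<Rightarrow> real" where "bump \<equiv> flat 1"
definition bump' :: "real \<Rightarrow> real" where "bump' = flat (pCons 0 (pCons 0 1))"

lemma bump_deriv: "(bump has_real_derivative bump' x) (at x)"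
  using flat_deriv[of 1 x] by (simp add: bump'_def)

lemma bump_bounds: "0 \<le> bump x" "bump x \<le> 1"
  by (auto simp: flat_def)

lemma bump_eq_0_iff: "bump x = 0 \<longleftrightarrow> x \<le> 0"
  by (auto simp: flat_def)

lemma bump'_eq_0: "x \<le> 0 \<Longrightarrow> bump' x = 0"
  by (auto simp: flat_def bump'_def)

lemma bump_tendsto: "(bump \<longlongrightarrow> 1) at_top"
proof -
  have "((\<lambda>x::real. exp (- (1 / x))) \<longlongrightarrow> exp (- 0)) at_top"
    by (intro tendsto_intros tendsto_divide_0[OF tendsto_const] filterlim_at_top_imp_at_infinity
        filterlim_ident)
  then have "((\<lambda>x::real. exp (- (1 / x))) \<longlongrightarrow> 1) at_top" by simp
  then show ?thesis
    by (rule Lim_transform_eventually)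
       (auto intro!: eventually_mono[OF eventually_gt_at_top[of 0]] simp: flat_def)
qed

text \<open>The scale invariant size \<open>(x+1) bump' x\<close>: it will multiply the derivative of a cutoff at
  distance \<open>\<epsilon> (x+1)\<close> from an endpoint.\<close>

lemma bump'_bound: "(x + 1) * bump' x \<le> 2"
proof -
  have "(x + 1) * bump' x \<le> 2" if "x > 0"
  proof -
    define t where "t = 1 / x"
    have t: "t > 0" "x = 1 / t" using that by (auto simp: t_def)
    have "1 + t + t\<^sup>2 / 2 \<le> exp t" using exp_lower_Taylor_quadratic[of t] t by simp
    moreover have "(x + 1) * bump' x = (t + t\<^sup>2) / exp t"
      using t(1) unfolding t(2) by (simp add: bump'_def flat_def exp_minus field_simps power2_eq_square)
    ultimately show ?thesis using t by (simp add: divide_le_eq)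
  qed
  then show ?thesis by (cases "x > 0") (auto simp: bump'_eq_0)
qed

lemma bump'_tendsto: "((\<lambda>x. (x + 1) * bump' x) \<longlongrightarrow> 0) at_top"
proof -
  have "((\<lambda>x::real. (1 / x + (1 / x)\<^sup>2) * exp (- (1 / x))) \<longlongrightarrow> (0 + 0\<^sup>2) * exp (- 0)) at_top"
    by (intro tendsto_intros tendsto_divide_0[OF tendsto_const] filterlim_at_top_imp_at_infinity
        filterlim_ident)
  then have "((\<lambda>x::real. (1 / x + (1 / x)\<^sup>2) * exp (- (1 / x))) \<longlongrightarrow> 0) at_top" by simp
  then show ?thesis
    by (rule Lim_transform_eventually)
       (auto intro!: eventually_mono[OF eventually_gt_at_top[of 0]]
          simp: flat_def bump'_def field_simps power2_eq_square)
qed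

text \<open>The parameter \<open>e\<close> is the width of the transition: as it tends to \<open>0\<close>, the cutoff tends to the indicator
  of the open interval, pointwise and without losing smoothness.\<close>

definition cutoff :: "real \<Rightarrow> real \<Rightarrow> real \<Rightarrow> real \<Rightarrow> real" where
  "cutoff a b e x = bump ((x - a) / e) * bump ((b - x) / e)"

definition cutoff' :: "real \<Rightarrow> real \<Rightarrow> real \<Rightarrow> real \<Rightarrow> real" where
  "cutoff' a b e x = (bump' ((x - a) / e) * bump ((b - x) / e) - bump ((x - a) / e) * bump' ((b - x) / e)) / e"

lemma cutoff_deriv: "(cutoff a b e has_real_derivative cutoff' a b e x) (at x)"
proof -
  have "((\<lambda>x. bump ((x - a) / e)) has_real_derivative bump' ((x - a) / e) * (1 / e)) (at x)"
    by (rule DERIV_chain2[OF bump_deriv]) (cases "e = 0"; auto intro!: derivative_eq_intros)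
  moreover have "((\<lambda>x. bump ((b - x) / e)) has_real_derivative bump' ((b - x) / e) * (- 1 / e)) (at x)"
    by (rule DERIV_chain2[OF bump_deriv]) (cases "e = 0"; auto intro!: derivative_eq_intros)
  ultimately show ?thesis
    unfolding cutoff_def[abs_def] cutoff'_def
    by (auto intro!: derivative_eq_intros simp: diff_divide_distrib)
qed

lemma continuous_on_cutoff: "continuous_on A (cutoff a b e)"
  by (rule DERIV_continuous_on[OF has_field_derivative_at_within[OF cutoff_deriv]])

lemma continuous_on_cutoff':
  assumes "e > 0" shows "continuous_on A (cutoff' a b e)"
proof -
  have "continuous_on UNIV bump'"
    unfolding bump'_def by (rule DERIV_continuous_on[OF has_field_derivative_at_within[OF flat_deriv]])
  moreover have "continuous_on UNIV bump"
    by (rule DERIV_continuous_on[OF has_field_derivative_at_within[OF bump_deriv]])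
  moreover have "continuous_on A (\<lambda>x. (x - a) / e)" "continuous_on A (\<lambda>x. (b - x) / e)"
    using assms by (auto intro!: continuous_intros)
  ultimately have "continuous_on A (\<lambda>x. bump' ((x - a) / e))" "continuous_on A (\<lambda>x. bump ((x - a) / e))"
    "continuous_on A (\<lambda>x. bump' ((b - x) / e))" "continuous_on A (\<lambda>x. bump ((b - x) / e))"
    by (auto intro: continuous_on_compose2[where t = UNIV])
  with assms show ?thesis
    unfolding cutoff'_def[abs_def] by (auto intro!: continuous_intros)
qed

lemma cutoff_bounds: "0 \<le> cutoff a b e x" "cutoff a b e x \<le> 1"
  unfolding cutoff_def using bump_bounds by (auto intro: mult_le_one)

lemma abs_mult_cutoff_le: "\<bar>z * cutoff a b e x\<bar> \<le> \<bar>z\<bar>"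
proof -
  have "\<bar>z * cutoff a b e x\<bar> = \<bar>z\<bar> * cutoff a b e x"
    by (simp only: abs_mult abs_of_nonneg[OF cutoff_bounds(1)])
  also have "\<dots> \<le> \<bar>z\<bar>" by (rule mult_right_le_one_le[OF _ cutoff_bounds]) simp
  finally show ?thesis .
qed

lemma abs_cutoff_mult_le: "\<bar>cutoff a b e x * z\<bar> \<le> \<bar>z\<bar>"
  using abs_mult_cutoff_le[of z a b e x] by (simp only: mult.commute[of z])

lemma diffs_on_cutoff: "diffs_on n UNIV (cutoff a b e)"
proof -
  have "diffs_on n UNIV (\<lambda>x. bump ((1/e) * x + (- a/e)) * bump ((-1/e) * x + b/e))"
    by (intro diffs_on_mult diffs_on_affine diffs_on_flat)
  then show ?thesis by (simp add: cutoff_def[abs_def] diff_divide_distrib)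
qed

lemma cutoff_outside: "e > 0 \<Longrightarrow> x \<notin> {a<..<b} \<Longrightarrow> cutoff a b e x = 0"
  by (auto simp: cutoff_def bump_eq_0_iff divide_le_0_iff not_less)

text \<open>The function \<open>F\<close> to be tested with contains powers of \<open>r\<close> with real exponents and is smooth only inside
  the interval; the support of the cutoff stays away from the endpoints.\<close>

lemma cutoff_mult_test_function:
  assumes F: "\<And>n. diffs_on n {0<..<R} F" and ab: "0 < a" "a \<le> b" "b < R" and e: "e > 0"
  shows "(\<lambda>x. F x * cutoff a b e x) \<in> test_functions R"
proof -
  let ?\<phi> = "\<lambda>x. F x * cutoff a b e x"
  have "diffs_on n ({0<..<R} \<union> - {a..b}) ?\<phi>" for n
  proof (rule diffs_on_Un)
    show "diffs_on n {0<..<R} ?\<phi>"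
      by (intro diffs_on_mult F diffs_on_subset[OF diffs_on_cutoff]) auto
    show "diffs_on n (- {a..b}) ?\<phi>"
      by (rule diffs_on_cong[OF _ _ diffs_on_const[of _ _ 0]]) (auto simp: cutoff_outside e)
  qed auto
  moreover have "{0<..<R} \<union> - {a..b} = UNIV" using ab by auto
  ultimately have "(deriv ^^ n) ?\<phi> differentiable (at x)" for n x
    using diffs_on_funpow_deriv[of UNIV n ?\<phi> x] by simp
  moreover have "\<exists>K. compact K \<and> K \<subseteq> {0<..<R} \<and> (\<forall>x. x \<notin> K \<longrightarrow> ?\<phi> x = 0)"
    by (rule exI[of _ "{a..b}"]) (use ab e in \<open>auto simp: cutoff_outside\<close>)
  ultimately show ?thesis unfolding test_functions_def by blast
qed

section \<open>Weak derivatives on an interval\<close>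

lemma compact_subset_interval:
  fixes K :: "real set"
  assumes "compact K" "K \<subseteq> {0<..<R}" "R > 0"
  obtains a b where "0 < a" "a < b" "b < R" "K \<subseteq> {a<..<b}"
proof (cases "K = {}")
  case True
  with assms show ?thesis by (intro that[of "R/3" "R/2"]) auto
next
  case False
  obtain x y where x: "x \<in> K" "\<And>t. t \<in> K \<Longrightarrow> x \<le> t" and y: "y \<in> K" "\<And>t. t \<in> K \<Longrightarrow> t \<le> y"
    using compact_attains_inf[OF assms(1) False] compact_attains_sup[OF assms(1) False] by blast
  with assms(2) have "0 < x" "x \<le> y" "y < R" by auto
  then show ?thesis using x y by (intro that[of "x/2" "(y+R)/2"]) force+
qed

lemma exhaust_interval:
  fixes x R :: real assumes "0 < x" "x < R"
  obtains n :: nat where "x \<in> {1 / real (Suc n) .. R - 1 / real (Suc n)}"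
proof -
  obtain n where "inverse (real (Suc n)) < min x (R - x)"
    using reals_Archimedean[of "min x (R - x)"] assms by auto
  then show ?thesis by (intro that[of n]) (auto simp: inverse_eq_divide)
qed

lemma leb_ivl_measurable_continuous:
  fixes f :: "real \<Rightarrow> real"
  assumes "continuous_on {0<..<R} f"
  shows "f \<in> borel_measurable (leb_ivl R)"
  using borel_measurable_continuous_on_restrict[OF assms]
  by (simp cong: measurable_cong_sets add: sets_restrict_space)

lemma L1_loc_integrable:
  assumes "f \<in> L1_loc R" "0 < c" "d < R"
  shows "integrable lborel (\<lambda>x. indicator {c..d} x * f x)"
proof -
  have "integrable (restrict_space lborel {c..d}) f"
    using assms unfolding L1_loc_def by (auto dest!: spec[of _ "{c..d}"])
  then show ?thesis by (simp add: integrable_restrict_space)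
qed

lemma L1_loc_measurable:
  assumes "f \<in> L1_loc R"
  shows "f \<in> borel_measurable (leb_ivl R)"
proof (rule measurable_piecewise_restrict[where C = "range (\<lambda>n. {1 / real (Suc n) .. R - 1 / real (Suc n)})"])
  show "space (leb_ivl R) \<subseteq> \<Union> (range (\<lambda>n. {1 / real (Suc n)..R - 1 / real (Suc n)}))"
    using exhaust_interval by (fastforce simp: space_restrict_space)
  fix \<Omega> assume "\<Omega> \<in> range (\<lambda>n. {1 / real (Suc n) .. R - 1 / real (Suc n)})"
  then obtain n where \<Omega>: "\<Omega> = {1 / real (Suc n) .. R - 1 / real (Suc n)}" by auto
  have sub: "\<Omega> \<subseteq> {0<..<R}"
  proof
    fix x assume "x \<in> \<Omega>"
    moreover have "0 < 1 / real (Suc n)" by simp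
    ultimately show "x \<in> {0<..<R}"
      unfolding \<Omega> atLeastAtMost_iff greaterThanLessThan_iff by linarith
  qed
  show "\<Omega> \<inter> space (leb_ivl R) \<in> sets (leb_ivl R)"
    by (auto simp: \<Omega> sets_restrict_space space_restrict_space)
  have "f \<in> borel_measurable (restrict_space lborel \<Omega>)"
    using assms sub \<Omega> unfolding L1_loc_def by auto
  moreover have "{0<..<R} \<inter> \<Omega> = \<Omega>" using sub by auto
  ultimately show "f \<in> borel_measurable (restrict_space (leb_ivl R) \<Omega>)"
    by (simp add: restrict_restrict_space \<Omega>)
qed auto

lemma L1_loc_continuous:
  assumes "continuous_on {0<..<R} f"
  shows "f \<in> L1_loc R"
  unfolding L1_loc_def
proof (intro CollectI allI impI)
  fix K :: "real set" assume K: "compact K" "K \<subseteq> {0<..<R}"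
  have "integrable lborel (\<lambda>x. indicator K x *\<^sub>R f x)"
    by (rule borel_integrable_compact[OF K(1) continuous_on_subset[OF assms K(2)]])
  then show "integrable (restrict_space lborel K) f"
    using K(1) by (subst integrable_restrict_space) (auto intro: borel_compact)
qed

text \<open>The open intervals form an intersection-stable generator of the Borel sets, so the integral vanishes
  over every Borel set.\<close>

lemma AE_zero_if_interval_integrals_zero:
  fixes f :: "real \<Rightarrow> real"
  assumes int: "integrable lborel f"
    and zero: "\<And>a b. a < b \<Longrightarrow> (\<integral>x. indicator {a<..<b} x * f x \<partial>lborel) = 0"
  shows "AE x in lborel. f x = 0"
proof (rule sigma_finite_measure.density_zero[OF lborel.sigma_finite_measure_axioms int])
  let ?I = "\<lambda>A. \<integral>x. indicator A x * f x \<partial>lborel"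
  have intA: "integrable lborel (\<lambda>x. indicator A x * f x)" if "A \<in> sets borel" for A
    using integrable_mult_indicator[OF _ int, of A] that by simp
  have univ: "?I UNIV = 0"
  proof -
    have "(\<lambda>n. ?I {- real (Suc n)<..<real (Suc n)}) \<longlonglongrightarrow> ?I UNIV"
    proof (rule integral_dominated_convergence[where w = "\<lambda>x. norm (f x)"])
      show "AE x in lborel. (\<lambda>n. indicator {- real (Suc n)<..<real (Suc n)} x * f x)
          \<longlonglongrightarrow> indicator UNIV x * f x"
      proof (rule AE_I2, rule tendsto_eventually)
        fix x :: real
        have "\<forall>\<^sub>F n in sequentially. n > nat \<lceil>\<bar>x\<bar>\<rceil>" by (rule eventually_gt_at_top)
        then show "\<forall>\<^sub>F n in sequentially. indicator {- real (Suc n)<..<real (Suc n)} x * f x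
            = indicator UNIV x * f x"
        proof eventually_elim
          case (elim n)
          then have "\<bar>x\<bar> < real (Suc n)" by linarith
          then have "x \<in> {- real (Suc n)<..<real (Suc n)}" by (auto simp: abs_less_iff)
          then show ?case by simp
        qed
      qed
    qed (use int in \<open>auto simp: indicator_def split: if_splits\<close>)
    moreover have "?I {- real (Suc n)<..<real (Suc n)} = 0" for n by (rule zero) auto
    ultimately show ?thesis using LIMSEQ_unique[OF _ tendsto_const] by (simp add: LIMSEQ_const_iff)
  qed
  have gen: "(borel :: real measure) = sigma UNIV (range (\<lambda>(a, b). {a<..<b}))"
    using borel_eq_box[where 'a = real] by simp
  fix A :: "real set" assume "A \<in> sets lborel"
  then have A: "A \<in> sigma_sets UNIV (range (\<lambda>(a, b). {a<..<b::real}))"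
    by (simp add: gen)
  have stable: "Int_stable (range (\<lambda>(a, b). {a<..<b::real}))"
  proof (rule Int_stableI)
    fix X Y :: "real set"
    assume "X \<in> range (\<lambda>(a, b). {a<..<b})" "Y \<in> range (\<lambda>(a, b). {a<..<b})"
    then obtain a b c d where XY: "X = {a<..<b}" "Y = {c<..<d}" by auto
    have "X \<inter> Y = (\<lambda>(a, b). {a<..<b}) (max a c, min b d)" unfolding XY by auto
    then show "X \<inter> Y \<in> range (\<lambda>(a, b). {a<..<b})" by (rule range_eqI)
  qed
  have "range (\<lambda>(a, b). {a<..<b::real}) \<subseteq> Pow UNIV" by simp
  from stable this A have "?I A = 0"
  proof (induction rule: sigma_sets_induct_disjoint)
    case (basic A)
    then obtain a b where A: "A = {a<..<b}" by auto
    show ?case unfolding A by (cases "a < b") (auto simp: zero)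
  next
    case empty
    show ?case by simp
  next
    case (compl A)
    then have "A \<in> sets borel" by (simp add: gen)
    have "?I (UNIV - A) = (\<integral>x. indicator UNIV x * f x - indicator A x * f x \<partial>lborel)"
      by (intro Bochner_Integration.integral_cong) (auto simp: indicator_def)
    also have "\<dots> = ?I UNIV - ?I A"
      by (intro Bochner_Integration.integral_diff intA) (use \<open>A \<in> sets borel\<close> in auto)
    finally show ?case using compl univ by simp
  next
    case (union A)
    then have A: "A i \<in> sets borel" for i by (simp add: gen image_subset_iff)
    have "(\<integral>x\<in>(\<Union>i. A i). f x \<partial>lborel) = (\<Sum>i. \<integral>x\<in>A i. f x \<partial>lborel)"
    proof (rule lebesgue_integral_countable_add)
      show "set_integrable lborel (\<Union>i. A i) f"
        unfolding set_integrable_def using intA[of "\<Union>i. A i"] A by auto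
      show "i \<noteq> j \<Longrightarrow> A i \<inter> A j = {}" for i j
        using union by (auto simp: disjoint_family_on_def)
    qed (use A in auto)
    then show ?case using union by (simp add: set_lebesgue_integral_def)
  qed
  then show "(\<integral>x\<in>A. f x \<partial>lborel) = 0" by (simp add: set_lebesgue_integral_def)
qed

lemma cutoff_tendsto_indicator:
  assumes e: "\<And>n. e n > 0" "e \<longlonglongrightarrow> 0"
  shows "(\<lambda>n. cutoff a b (e n) x) \<longlonglongrightarrow> indicator {a<..<b} x"
proof (cases "x \<in> {a<..<b}")
  case True
  have *: "filterlim (\<lambda>n. c / e n) at_top sequentially" if "c > 0" for c
    by (rule LIM_at_top_divide[OF tendsto_const that e(2)]) (simp add: e)
  have "(\<lambda>n. cutoff a b (e n) x) \<longlonglongrightarrow> 1 * 1"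
    unfolding cutoff_def using True by (intro tendsto_mult filterlim_compose[OF bump_tendsto] *) auto
  with True show ?thesis by simp
next
  case False
  then show ?thesis using cutoff_outside[OF e(1) False] by simp
qed

text \<open>Cutoffs are test functions that converge boundedly to indicators of intervals, hence the integrals
  over all compact subintervals are zero.\<close>

lemma weakly_zero_imp_AE_zero:
  assumes u: "u \<in> L1_loc R"
    and zero: "\<And>\<phi>. \<phi> \<in> test_functions R \<Longrightarrow> (\<integral>r. u r * \<phi> r \<partial>leb_ivl R) = 0"
  shows "AE r in leb_ivl R. u r = 0"
proof -
  have *: "AE x in lborel. indicator {c..d} x * u x = 0" if cd: "0 < c" "d < R" for c d
  proof (rule AE_zero_if_interval_integrals_zero[OF L1_loc_integrable[OF u cd]])
    fix a b :: real assume "a < b"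
    \<comment> \<open>Intersecting with \<open>{c..d}\<close> keeps the supports of the cutoffs inside \<open>(0,R)\<close>.\<close>
    define a' b' where "a' = max a c" and "b' = min b d"
    have eqI: "(\<integral>x. indicator {a<..<b} x * (indicator {c..d} x * u x) \<partial>lborel)
        = (\<integral>x. indicator {a'<..<b'} x * (indicator {c..d} x * u x) \<partial>lborel)"
    proof (rule integral_cong_AE)
      show "AE x in lborel. indicator {a<..<b} x * (indicator {c..d} x * u x) =
         indicator {a'<..<b'} x * (indicator {c..d} x * u x)"
        using AE_lborel_singleton[of c] AE_lborel_singleton[of d]
        by eventually_elim (auto simp: a'_def b'_def indicator_def)
    qed (use L1_loc_integrable[OF u cd] in auto)
    show "(\<integral>x. indicator {a<..<b} x * (indicator {c..d} x * u x) \<partial>lborel) = 0"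
    proof (cases "a' < b'")
      case False
      then show ?thesis unfolding eqI by simp
    next
      case True
      have ab: "0 < a'" "a' \<le> b'" "b' < R" "c \<le> a'" "b' \<le> d"
        using cd True by (auto simp: a'_def b'_def)
      let ?e = "\<lambda>n. 1 / real (Suc n)"
      have "(\<lambda>n. \<integral>x. cutoff a' b' (?e n) x * (indicator {c..d} x * u x) \<partial>lborel) \<longlonglongrightarrow>
          (\<integral>x. indicator {a'<..<b'} x * (indicator {c..d} x * u x) \<partial>lborel)"
      proof (rule integral_dominated_convergence[where w = "\<lambda>x. norm (indicator {c..d} x * u x)"])
        show "AE x in lborel. (\<lambda>n. cutoff a' b' (?e n) x * (indicator {c..d} x * u x))
            \<longlonglongrightarrow> indicator {a'<..<b'} x * (indicator {c..d} x * u x)"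
          by (intro AE_I2 tendsto_mult cutoff_tendsto_indicator tendsto_const LIMSEQ_Suc[OF lim_1_over_n]) auto
        have "cutoff a' b' e \<in> borel_measurable borel" for e
          by (intro borel_measurable_continuous_onI continuous_on_cutoff)
        then show "(\<lambda>x. cutoff a' b' (?e n) x * (indicator {c..d} x * u x)) \<in> borel_measurable lborel" for n
          by (intro borel_measurable_times borel_measurable_integrable[OF L1_loc_integrable[OF u cd]]) simp
        show "AE x in lborel. norm (cutoff a' b' (?e n) x * (indicator {c..d} x * u x))
            \<le> norm (indicator {c..d} x * u x)" for n
          unfolding real_norm_def
          by (intro AE_I2 abs_cutoff_mult_le)
      qed (use L1_loc_integrable[OF u cd] in auto)
      moreover have "(\<integral>x. cutoff a' b' (?e n) x * (indicator {c..d} x * u x) \<partial>lborel) = 0" for n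
      proof -
        have "(\<lambda>x. 1 * cutoff a' b' (?e n) x) \<in> test_functions R"
          by (rule cutoff_mult_test_function[OF diffs_on_const]) (use ab in auto)
        then have "(\<integral>r. u r * cutoff a' b' (?e n) r \<partial>leb_ivl R) = 0"
          using zero by simp
        also have "(\<integral>r. u r * cutoff a' b' (?e n) r \<partial>leb_ivl R)
            = (\<integral>x. cutoff a' b' (?e n) x * (indicator {c..d} x * u x) \<partial>lborel)"
          using ab cd by (auto simp: integral_restrict_space indicator_def cutoff_outside
              intro!: Bochner_Integration.integral_cong)
        finally show ?thesis .
      qed
      ultimately show ?thesis unfolding eqI by (simp add: LIMSEQ_const_iff)
    qed
  qed
  have "AE x in lborel. \<forall>n. indicator {1 / real (Suc n) .. R - 1 / real (Suc n)} x * u x = 0"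
    by (subst AE_all_countable, rule allI, rule *) auto
  then have "AE x in lborel. x \<in> {0<..<R} \<longrightarrow> u x = 0"
  proof eventually_elim
    case (elim x)
    show ?case
    proof
      assume "x \<in> {0<..<R}"
      then obtain n where "x \<in> {1 / real (Suc n) .. R - 1 / real (Suc n)}"
        using exhaust_interval by auto
      with elim[rule_format, of n] show "u x = 0" by simp
    qed
  qed
  then show ?thesis by (simp add: AE_restrict_space_iff)
qed

lemma test_function_derivative:
  assumes "\<phi> \<in> test_functions R" "R > 0"
  obtains a b where "0 < a" "a < b" "b < R" "\<And>x. x \<notin> {a<..<b} \<Longrightarrow> \<phi> x = 0"
    "\<And>x. x \<notin> {a<..<b} \<Longrightarrow> deriv \<phi> x = 0" "\<And>x. (\<phi> has_real_derivative deriv \<phi> x) (at x)"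
    "continuous_on UNIV \<phi>" "continuous_on UNIV (deriv \<phi>)"
proof -
  from assms obtain K where K: "compact K" "K \<subseteq> {0<..<R}" "\<And>x. x \<notin> K \<Longrightarrow> \<phi> x = 0"
    and D: "\<And>n x. ((deriv ^^ n) \<phi>) differentiable (at x)"
    unfolding test_functions_def by blast
  obtain a b where ab: "0 < a" "a < b" "b < R" "K \<subseteq> {a<..<b}"
    using compact_subset_interval[OF K(1,2) assms(2)] by blast
  show ?thesis
  proof (rule that[OF ab(1-3)])
    show "\<phi> x = 0" if "x \<notin> {a<..<b}" for x using that ab(4) K(3)[of x] by blast
    show "deriv \<phi> x = 0" if "x \<notin> {a<..<b}" for x
    proof (rule DERIV_imp_deriv, rule has_field_derivative_transform_within_open[where S = "- K"])
      show "((\<lambda>x. 0) has_real_derivative 0) (at x)" by simp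
    qed (use that ab K in \<open>auto simp: compact_imp_closed open_Compl\<close>)
    show "(\<phi> has_real_derivative deriv \<phi> x) (at x)" for x
      using D[of 0 x] by (simp add: DERIV_deriv_iff_real_differentiable)
    show "continuous_on UNIV \<phi>" "continuous_on UNIV (deriv \<phi>)"
      using D[of 0] D[of 1] by (auto simp: continuous_on_eq_continuous_at differentiable_imp_continuous_within)
  qed
qed

lemma test_function_integrable:
  assumes "u \<in> L1_loc R" "continuous_on UNIV \<psi>" "0 < a" "b < R" "\<And>x. x \<notin> {a<..<b} \<Longrightarrow> \<psi> x = 0"
  shows "integrable (leb_ivl R) (\<lambda>r. u r * \<psi> r)"
proof -
  obtain B where B: "\<And>x. x \<in> {a..b} \<Longrightarrow> \<bar>\<psi> x\<bar> \<le> B"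
    using continuous_on_subset[OF assms(2), of "{a..b}"]
    by (metis bounded_real compact_Icc compact_continuous_image compact_imp_bounded image_eqI subset_UNIV)
  have "integrable lborel (\<lambda>x. indicator {a..b} x * u x)"
    by (rule L1_loc_integrable) (use assms in auto)
  then have "integrable lborel (\<lambda>x. B * (indicator {a..b} x * u x))" by simp
  then have "integrable lborel (\<lambda>x. (indicator {a..b} x * u x) * \<psi> x)"
  proof (rule Bochner_Integration.integrable_bound)
    have "\<psi> \<in> borel_measurable borel" by (rule borel_measurable_continuous_onI) fact
    then show "(\<lambda>x. (indicator {a..b} x * u x) * \<psi> x) \<in> borel_measurable lborel"
      by (intro borel_measurable_times borel_measurable_integrable[OF L1_loc_integrable[OF assms(1,3,4)]]) simp
    show "AE x in lborel. norm (indicator {a..b} x * u x * \<psi> x) \<le> norm (B * (indicator {a..b} x * u x))"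
    proof (rule AE_I2)
      fix x
      show "norm (indicator {a..b} x * u x * \<psi> x) \<le> norm (B * (indicator {a..b} x * u x))"
        using B[of x] mult_right_mono[of "\<bar>\<psi> x\<bar>" "\<bar>B\<bar>" "\<bar>u x\<bar>"]
        by (cases "x \<in> {a..b}") (auto simp: abs_mult mult.commute)
    qed
  qed
  moreover have "(\<lambda>x. indicator {a..b} x * u x * \<psi> x) = (\<lambda>x. indicator {0<..<R} x *\<^sub>R (u x * \<psi> x))"
  proof
    fix x
    show "indicator {a..b} x * u x * \<psi> x = indicator {0<..<R} x *\<^sub>R (u x * \<psi> x)"
      using assms(3,4) assms(5)[of x] by (cases "x \<in> {a<..<b}") (auto simp: indicator_def)
  qed
  ultimately show ?thesis by (simp add: integrable_restrict_space)
qed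

text \<open>This identifies the chosen \<open>wderiv\<close> of a classically differentiable function.\<close>

lemma weak_derivative_unique:
  assumes u1: "is_weak_deriv R v u1" and u2: "is_weak_deriv R v u2" and R: "R > 0"
  shows "AE r in leb_ivl R. u1 r = u2 r"
proof -
  have L: "u1 \<in> L1_loc R" "u2 \<in> L1_loc R" using u1 u2 by (auto simp: is_weak_deriv_def)
  have "AE r in leb_ivl R. u1 r - u2 r = 0"
  proof (rule weakly_zero_imp_AE_zero)
    show "(\<lambda>r. u1 r - u2 r) \<in> L1_loc R" using L unfolding L1_loc_def by auto
    fix \<phi> assume \<phi>: "\<phi> \<in> test_functions R"
    obtain a b where ab: "0 < a" "b < R" "\<And>x. x \<notin> {a<..<b} \<Longrightarrow> \<phi> x = 0" "continuous_on UNIV \<phi>"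
      using test_function_derivative[OF \<phi> R] by metis
    have "(\<integral>r. (u1 r - u2 r) * \<phi> r \<partial>leb_ivl R)
        = (\<integral>r. u1 r * \<phi> r \<partial>leb_ivl R) - (\<integral>r. u2 r * \<phi> r \<partial>leb_ivl R)"
      unfolding left_diff_distrib
      by (intro Bochner_Integration.integral_diff test_function_integrable[OF L(1) ab(4,1,2,3)]
          test_function_integrable[OF L(2) ab(4,1,2,3)])
    also have "\<dots> = 0"
    proof -
      have "(\<integral>r. v r * deriv \<phi> r \<partial>leb_ivl R) = - (\<integral>r. u1 r * \<phi> r \<partial>leb_ivl R)"
        "(\<integral>r. v r * deriv \<phi> r \<partial>leb_ivl R) = - (\<integral>r. u2 r * \<phi> r \<partial>leb_ivl R)"
        using u1 u2 \<phi> by (auto simp: is_weak_deriv_def)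
      then show ?thesis by linarith
    qed
    finally show "(\<integral>r. (u1 r - u2 r) * \<phi> r \<partial>leb_ivl R) = 0" .
  qed
  then show ?thesis by simp
qed

lemma weak_derivative_wderiv: "is_weak_deriv R v u \<Longrightarrow> is_weak_deriv R v (wderiv R v)"
  unfolding wderiv_def by (rule someI[of "is_weak_deriv R v"])

lemma classical_derivative_is_weak:
  assumes v: "\<And>r. r \<in> {0<..<R} \<Longrightarrow> (v has_real_derivative p r) (at r)"
    and p: "continuous_on {0<..<R} p" and R: "R > 0"
  shows "is_weak_deriv R v p"
proof -
  have vc: "continuous_on {0<..<R} v"
    by (rule DERIV_continuous_on[OF has_field_derivative_at_within[OF v]])
  have L: "v \<in> L1_loc R" "p \<in> L1_loc R" using L1_loc_continuous vc p by auto
  have "(\<integral>r. v r * deriv \<phi> r \<partial>leb_ivl R) = - (\<integral>r. p r * \<phi> r \<partial>leb_ivl R)"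
    if \<phi>: "\<phi> \<in> test_functions R" for \<phi>
  proof -
    obtain a b where ab: "0 < a" "a < b" "b < R" "\<And>x. x \<notin> {a<..<b} \<Longrightarrow> \<phi> x = 0"
      "\<And>x. x \<notin> {a<..<b} \<Longrightarrow> deriv \<phi> x = 0" "\<And>x. (\<phi> has_real_derivative deriv \<phi> x) (at x)"
      "continuous_on UNIV \<phi>" "continuous_on UNIV (deriv \<phi>)"
      using test_function_derivative[OF \<phi> R] by metis
    have "(\<integral>r. v r * deriv \<phi> r \<partial>leb_ivl R) + (\<integral>r. p r * \<phi> r \<partial>leb_ivl R)
        = (\<integral>r. v r * deriv \<phi> r + p r * \<phi> r \<partial>leb_ivl R)"
      by (intro Bochner_Integration.integral_add[symmetric] test_function_integrable[where a = a and b = b] L ab)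
    also have "\<dots> = (\<integral>x. (v x * deriv \<phi> x + p x * \<phi> x) * indicator {a..b} x \<partial>lborel)"
      using ab by (auto simp: integral_restrict_space indicator_def intro!: Bochner_Integration.integral_cong)
    also have "\<dots> = v b * \<phi> b - v a * \<phi> a"
    proof (rule integral_FTC_Icc_real)
      show "((\<lambda>x. v x * \<phi> x) has_real_derivative v x * deriv \<phi> x + p x * \<phi> x) (at x)"
        if "a \<le> x" "x \<le> b" for x
        using that ab v[of x] by (auto intro!: derivative_eq_intros)
      have "continuous_on {0<..<R} (\<lambda>x. v x * deriv \<phi> x + p x * \<phi> x)"
        by (intro continuous_intros vc p continuous_on_subset[OF ab(7)] continuous_on_subset[OF ab(8)]) auto
      then show "isCont (\<lambda>x. v x * deriv \<phi> x + p x * \<phi> x) x" if "a \<le> x" "x \<le> b" for x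
        using that ab by (auto simp: continuous_on_eq_continuous_at)
    qed (use ab in auto)
    also have "\<dots> = 0" using ab by simp
    finally show ?thesis by simp
  qed
  with L show ?thesis unfolding is_weak_deriv_def by blast
qed

text \<open>If \<open>F\<close> vanishes linearly at both endpoints, relative to the weight \<open>\<rho>\<close>, then cutting it
  off at distance \<open>e\<close> from the endpoints costs a cutoff derivative of size \<open>1/e\<close>, which the linear vanishing
  compensates.\<close>

lemma cutoff'_weighted:
  fixes F :: real and r R e \<rho> :: real
  assumes "e > 0" "\<bar>F\<bar> \<le> r * \<rho>" "\<bar>F\<bar> \<le> (R - r) * \<rho>" "\<rho> \<ge> 0"
  defines "x \<equiv> (r - e) / e" and "y \<equiv> (R - e - r) / e"
  shows "\<bar>F * cutoff' e (R - e) e r\<bar> \<le> \<rho> * ((x + 1) * bump' x + (y + 1) * bump' y)"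
proof -
  have nn: "0 \<le> bump' z" for z by (auto simp: bump'_def flat_def)
  have xy: "x + 1 = r / e" "y + 1 = (R - r) / e"
    using assms(1) by (auto simp: x_def y_def field_simps)
  have "\<bar>F * cutoff' e (R - e) e r\<bar> = \<bar>F\<bar> / e * \<bar>bump' x * bump y - bump x * bump' y\<bar>"
    using assms(1) by (simp add: cutoff'_def x_def y_def abs_mult)
  also have "\<dots> \<le> \<bar>F\<bar> / e * (bump' x * 1 + 1 * bump' y)"
  proof (rule mult_left_mono)
    have "bump' x * bump y \<le> bump' x * 1" "bump x * bump' y \<le> 1 * bump' y"
      "0 \<le> bump' x * bump y" "0 \<le> bump x * bump' y"
      using nn bump_bounds by (intro mult_left_mono mult_right_mono mult_nonneg_nonneg; simp)+
    then show "\<bar>bump' x * bump y - bump x * bump' y\<bar> \<le> bump' x * 1 + 1 * bump' y" by linarith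
  qed (use assms in auto)
  also have "\<dots> = \<bar>F\<bar> / e * bump' x + \<bar>F\<bar> / e * bump' y" by (simp add: distrib_left)
  also have "\<dots> \<le> (r * \<rho>) / e * bump' x + ((R - r) * \<rho>) / e * bump' y"
    using assms nn by (intro add_mono mult_right_mono divide_right_mono) auto
  finally show ?thesis unfolding xy by (simp add: algebra_simps)
qed

text \<open>The weak derivative is tested with \<open>F\<close> times a cutoff of width \<open>R/(n+2)\<close>. The term with the derivative
  of the cutoff is bounded by \<open>4 \<bar>v\<bar> \<rho>\<close> and tends to \<open>0\<close> pointwise, so that dominated convergence
  replaces any estimate of \<open>v\<close> at the endpoints.\<close>

lemma weak_integration_by_parts:
  assumes R: "R > 0" and weak: "is_weak_deriv R v u"
    and F: "\<And>n. diffs_on n {0<..<R} F" "\<And>r. r \<in> {0<..<R} \<Longrightarrow> (F has_real_derivative f r) (at r)"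
    and f: "continuous_on {0<..<R} f"
    and left: "\<And>r. r \<in> {0<..<R} \<Longrightarrow> \<bar>F r\<bar> \<le> r * \<rho> r"
    and right: "\<And>r. r \<in> {0<..<R} \<Longrightarrow> \<bar>F r\<bar> \<le> (R - r) * \<rho> r"
    and int: "integrable (leb_ivl R) (\<lambda>r. v r * \<rho> r)" "integrable (leb_ivl R) (\<lambda>r. v r * f r)"
      "integrable (leb_ivl R) (\<lambda>r. u r * F r)"
  shows "(\<integral>r. v r * f r + u r * F r \<partial>leb_ivl R) = 0"
proof -
  define e where "e n = R / real (Suc (Suc n))" for n
  have e: "e n > 0" "e n \<le> R - e n" "R - e n < R" for n
    using R by (auto simp: e_def field_simps)
  have e0: "e \<longlonglongrightarrow> 0"
    unfolding e_def using LIMSEQ_Suc[OF LIMSEQ_Suc[OF lim_const_over_n[of R]]] by simp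
  let ?\<chi> = "\<lambda>n. cutoff (e n) (R - e n) (e n)"
  let ?\<chi>' = "\<lambda>n. cutoff' (e n) (R - e n) (e n)"
  have sp: "space (leb_ivl R) = {0<..<R}" by (simp add: space_restrict_space)
  note contM = leb_ivl_measurable_continuous
  have Fc: "continuous_on {0<..<R} F"
    by (rule DERIV_continuous_on[OF has_field_derivative_at_within[OF F(2)]])
  have \<chi>c: "continuous_on A (?\<chi> n)" and \<chi>'c: "continuous_on A (?\<chi>' n)" for n A
    by (auto intro: continuous_on_cutoff continuous_on_cutoff' e)
  have vM: "v \<in> borel_measurable (leb_ivl R)"
    using weak L1_loc_measurable by (auto simp: is_weak_deriv_def)
  have \<rho>0: "\<rho> r \<ge> 0" if "r \<in> {0<..<R}" for r
    using order_trans[OF abs_ge_zero left[OF that]] that by (auto simp: zero_le_mult_iff)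
  have far: "filterlim (\<lambda>n. (r - e n) / e n) at_top sequentially"
    "filterlim (\<lambda>n. (R - e n - r) / e n) at_top sequentially" if "r \<in> {0<..<R}" for r
  proof -
    have *: "filterlim (\<lambda>n. (c - e n) / e n) at_top sequentially" if "c > 0" for c
      by (rule LIM_at_top_divide[OF tendsto_diff[OF tendsto_const e0] _ e0]) (use that e in auto)
    from *[of r] *[of "R - r"] that show "filterlim (\<lambda>n. (r - e n) / e n) at_top sequentially"
      "filterlim (\<lambda>n. (R - e n - r) / e n) at_top sequentially"
      by (auto simp: algebra_simps)
  qed
  let ?h = "\<lambda>n r. ((r - e n) / e n + 1) * bump' ((r - e n) / e n)
      + ((R - e n - r) / e n + 1) * bump' ((R - e n - r) / e n)"
  have bound: "\<bar>v r * (F r * ?\<chi>' n r)\<bar> \<le> \<bar>v r * \<rho> r\<bar> * ?h n r" if "r \<in> {0<..<R}" for r n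
  proof -
    have "\<bar>v r\<bar> * \<bar>F r * ?\<chi>' n r\<bar> \<le> \<bar>v r\<bar> * (\<rho> r * ?h n r)"
      by (rule mult_left_mono[OF cutoff'_weighted[OF e(1) left[OF that] right[OF that] \<rho>0[OF that]]]) simp
    then show ?thesis using \<rho>0[OF that] by (simp add: abs_mult mult.assoc)
  qed
  have "\<bar>v r * (F r * ?\<chi>' n r)\<bar> \<le> \<bar>v r * \<rho> r\<bar> * 4" if "r \<in> {0<..<R}" for r n
    using bump'_bound[of "(r - e n) / e n"] bump'_bound[of "(R - e n - r) / e n"]
    by (intro order_trans[OF bound[OF that]] mult_left_mono) auto
  then have bound4: "AE r in leb_ivl R. norm (v r * (F r * ?\<chi>' n r)) \<le> \<bar>v r * \<rho> r\<bar> * 4" for n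
    by (intro AE_I2) (auto simp: sp)
  have int4: "integrable (leb_ivl R) (\<lambda>r. \<bar>v r * \<rho> r\<bar> * 4)" using int(1) by auto
  have meas: "(\<lambda>r. v r * (F r * ?\<chi>' n r)) \<in> borel_measurable (leb_ivl R)" for n
    by (intro borel_measurable_times vM contM Fc \<chi>'c)
  have h0: "(\<lambda>n. v r * (F r * ?\<chi>' n r)) \<longlonglongrightarrow> 0" if r: "r \<in> {0<..<R}" for r
  proof (rule tendsto_rabs_zero_cancel, rule tendsto_sandwich[OF _ _ tendsto_const])
    have "(\<lambda>n. \<bar>v r * \<rho> r\<bar> * ?h n r) \<longlonglongrightarrow> \<bar>v r * \<rho> r\<bar> * (0 + 0)"
      using far[OF r] by (intro tendsto_intros filterlim_compose[OF bump'_tendsto]) auto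
    then show "(\<lambda>n. \<bar>v r * \<rho> r\<bar> * ?h n r) \<longlonglongrightarrow> 0" by simp
    show "\<forall>\<^sub>F n in sequentially. \<bar>v r * (F r * ?\<chi>' n r)\<bar> \<le> \<bar>v r * \<rho> r\<bar> * ?h n r"
      using bound[OF r] by simp
  qed auto
  have lim0: "(\<lambda>n. \<integral>r. v r * (F r * ?\<chi>' n r) \<partial>leb_ivl R) \<longlonglongrightarrow> (\<integral>r. 0 \<partial>leb_ivl R)"
    by (rule integral_dominated_convergence[OF _ meas int4 _ bound4]) (auto intro!: AE_I2 h0 simp: sp)
  have vint: "integrable (leb_ivl R) (\<lambda>r. v r * (F r * ?\<chi>' n r))" for n
    by (rule Bochner_Integration.integrable_bound[OF int4 meas])
       (use bound4[of n] in \<open>auto elim: eventually_mono\<close>)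
  have cutint: "integrable (leb_ivl R) (\<lambda>r. g r * ?\<chi> n r)" if "integrable (leb_ivl R) g" for g n
    by (rule Bochner_Integration.integrable_bound[OF that])
       (use that abs_mult_cutoff_le in
         \<open>auto intro!: borel_measurable_times[OF borel_measurable_integrable contM[OF \<chi>c]] AE_I2\<close>)
  have key: "(\<integral>r. (v r * f r + u r * F r) * ?\<chi> n r \<partial>leb_ivl R) = - (\<integral>r. v r * (F r * ?\<chi>' n r) \<partial>leb_ivl R)" for n
  proof -
    let ?\<phi> = "\<lambda>r. F r * ?\<chi> n r"
    have "?\<phi> \<in> test_functions R"
      by (rule cutoff_mult_test_function[OF F(1)]) (use e[of n] in auto)
    then have w: "(\<integral>r. v r * deriv ?\<phi> r \<partial>leb_ivl R) = - (\<integral>r. u r * ?\<phi> r \<partial>leb_ivl R)"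
      using weak by (auto simp: is_weak_deriv_def)
    have "deriv ?\<phi> r = f r * ?\<chi> n r + F r * ?\<chi>' n r" if "r \<in> {0<..<R}" for r
      by (rule DERIV_imp_deriv) (use F(2)[OF that] in \<open>auto intro!: derivative_eq_intros cutoff_deriv\<close>)
    then have "(\<integral>r. v r * deriv ?\<phi> r \<partial>leb_ivl R)
        = (\<integral>r. (v r * f r) * ?\<chi> n r + v r * (F r * ?\<chi>' n r) \<partial>leb_ivl R)"
      by (intro Bochner_Integration.integral_cong) (auto simp: sp algebra_simps)
    also have "\<dots> = (\<integral>r. (v r * f r) * ?\<chi> n r \<partial>leb_ivl R) + (\<integral>r. v r * (F r * ?\<chi>' n r) \<partial>leb_ivl R)"
      by (intro Bochner_Integration.integral_add cutint int vint)
    finally have 1: "(\<integral>r. (v r * f r) * ?\<chi> n r \<partial>leb_ivl R) + (\<integral>r. (u r * F r) * ?\<chi> n r \<partial>leb_ivl R)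
        = - (\<integral>r. v r * (F r * ?\<chi>' n r) \<partial>leb_ivl R)"
      using w by (simp add: mult.assoc)
    show ?thesis
      unfolding 1[symmetric] distrib_right by (intro Bochner_Integration.integral_add cutint int)
  qed
  have "(\<lambda>n. \<integral>r. (v r * f r + u r * F r) * ?\<chi> n r \<partial>leb_ivl R) \<longlonglongrightarrow> (\<integral>r. v r * f r + u r * F r \<partial>leb_ivl R)"
  proof (rule integral_dominated_convergence[where w = "\<lambda>r. norm (v r * f r + u r * F r)"])
    show "AE r in leb_ivl R. (\<lambda>n. (v r * f r + u r * F r) * ?\<chi> n r) \<longlonglongrightarrow> v r * f r + u r * F r"
    proof (rule AE_I2)
      fix r assume "r \<in> space (leb_ivl R)"
      then have r: "r \<in> {0<..<R}" by (simp add: sp)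
      have "(\<lambda>n. ?\<chi> n r) \<longlonglongrightarrow> 1 * 1"
        unfolding cutoff_def using far[OF r] by (intro tendsto_mult filterlim_compose[OF bump_tendsto])
      from tendsto_mult[OF tendsto_const this, of "v r * f r + u r * F r"]
      show "(\<lambda>n. (v r * f r + u r * F r) * ?\<chi> n r) \<longlonglongrightarrow> v r * f r + u r * F r" by simp
    qed
    have g: "integrable (leb_ivl R) (\<lambda>r. v r * f r + u r * F r)" using int by auto
    show "(\<lambda>r. v r * f r + u r * F r) \<in> borel_measurable (leb_ivl R)" using g by auto
    show "(\<lambda>r. (v r * f r + u r * F r) * ?\<chi> n r) \<in> borel_measurable (leb_ivl R)" for n
      using cutint[OF g] by auto
    show "integrable (leb_ivl R) (\<lambda>r. norm (v r * f r + u r * F r))" using g by auto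
    show "AE r in leb_ivl R. norm ((v r * f r + u r * F r) * ?\<chi> n r) \<le> norm (v r * f r + u r * F r)" for n
      by (intro AE_I2) (simp only: real_norm_def abs_mult_cutoff_le)
  qed
  moreover have "(\<lambda>n. \<integral>r. (v r * f r + u r * F r) * ?\<chi> n r \<partial>leb_ivl R) \<longlonglongrightarrow> 0"
    unfolding key using tendsto_minus[OF lim0] by simp
  ultimately show ?thesis by (rule LIMSEQ_unique)
qed

section \<open>The weight and its primitives\<close>

lemma leb_ivl_continuous:
  fixes f :: "real \<Rightarrow> real"
  assumes "continuous_on {0..R} f"
  shows "integrable (leb_ivl R) f" and "(\<integral>r. f r \<partial>leb_ivl R) = integral {0..R} f"
proof -
  have si: "set_integrable lborel {0<..<R} f"
    by (rule set_integrable_subset[OF borel_integrable_atLeastAtMost'[OF assms]]) auto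
  then show "integrable (leb_ivl R) f"
    by (simp add: set_integrable_def integrable_restrict_space)
  have "(\<integral>r. f r \<partial>leb_ivl R) = (\<integral>r\<in>{0<..<R}. f r \<partial>lborel)"
    by (simp add: integral_restrict_space set_lebesgue_integral_def)
  also have "\<dots> = integral {0<..<R} f" by (rule set_borel_integral_eq_integral[OF si])
  finally show "(\<integral>r. f r \<partial>leb_ivl R) = integral {0..R} f"
    by (simp add: integral_open_interval_real)
qed

lemma leb_ivl_FTC:
  assumes "0 \<le> R" "continuous_on {0..R} f" "continuous_on {0..R} G"
    "\<And>r. 0 < r \<Longrightarrow> r < R \<Longrightarrow> (G has_real_derivative f r) (at r)"
  shows "(\<integral>r. f r \<partial>leb_ivl R) = G R - G 0"
proof -
  have "(f has_integral G R - G 0) {0..R}"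
    by (rule fundamental_theorem_of_calculus_interior)
       (use assms in \<open>auto simp: has_real_derivative_iff_has_vector_derivative\<close>)
  then show ?thesis using leb_ivl_continuous(2)[OF assms(2)] by (simp add: integral_unique)
qed

lemma w_at_0 [simp]: "w m 0 = 0" by (simp add: w_def)

lemma w_pos: "r > 0 \<Longrightarrow> w m r > 0" by (simp add: w_def)

lemma w_minus_one: "r > 0 \<Longrightarrow> w (m - 1) r = w m r / r"
  by (simp add: w_def powr_diff)

lemma continuous_on_w: "m > 0 \<Longrightarrow> S \<subseteq> {0..} \<Longrightarrow> continuous_on S (w m)"
  unfolding w_def by (intro continuous_intros continuous_on_powr') auto

lemma w_deriv: "r > 0 \<Longrightarrow> (w m has_real_derivative (m / r - r) * w m r) (at r)"
  unfolding w_def[abs_def]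
  by (auto intro!: derivative_eq_intros simp: powr_diff field_simps)

lemma w_le: "w m r \<le> r powr m"
  by (simp add: w_def mult_left_le)

text \<open>Up to a constant depending on \<open>R\<close> the weight is the power \<open>r^m\<close>, so its monotonicity up to
  constants can be used in estimates.\<close>

lemma le_w: "r \<in> {0..R} \<Longrightarrow> r powr m \<le> w m r * exp (R\<^sup>2 / 2)"
proof -
  assume "r \<in> {0..R}"
  then have "r\<^sup>2 \<le> R\<^sup>2" by (intro power_mono) auto
  then have "1 \<le> exp (- r\<^sup>2 / 2) * exp (R\<^sup>2 / 2)" by (simp flip: exp_add)
  from mult_left_mono[OF this, of "r powr m"] show ?thesis by (simp add: w_def mult.assoc)
qed

lemma W_at_0 [simp]: "W m 0 = 0"
  unfolding W_def by (simp add: integral_restrict_space)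

lemma W_eq_integral: "m > 0 \<Longrightarrow> W m r = integral {0..r} (w m)"
  unfolding W_def by (rule leb_ivl_continuous(2)[OF continuous_on_w]) auto

lemma W_deriv:
  assumes "m > 0" "r > 0"
  shows "(W m has_real_derivative w m r) (at r)"
proof -
  have "((\<lambda>x. integral {0..x} (w m)) has_real_derivative w m r) (at r within {0..r + 1})"
    by (rule integral_has_real_derivative[OF continuous_on_w]) (use assms in auto)
  moreover have "W m = (\<lambda>x. integral {0..x} (w m))"
    using W_eq_integral[OF assms(1)] by auto
  ultimately show ?thesis
    using assms by (simp add: at_within_Icc_at)
qed

lemma continuous_on_W:
  assumes "m > 0" shows "continuous_on {0..R} (W m)"
proof -
  have "continuous_on {0..R} (\<lambda>r. integral {0..r} (w m))"
    by (rule indefinite_integral_continuous_1[OF integrable_continuous_real[OF continuous_on_w]])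
       (use assms in auto)
  moreover have "W m = (\<lambda>x. integral {0..x} (w m))"
    using W_eq_integral[OF assms] by auto
  ultimately show ?thesis by simp
qed

lemma nonneg_of_deriv_nonneg:
  fixes f :: "real \<Rightarrow> real"
  assumes "0 \<le> R" "f 0 = 0" "continuous_on {0..R} f"
    "\<And>r. 0 < r \<Longrightarrow> r < R \<Longrightarrow> (f has_real_derivative f' r) (at r)"
    "\<And>r. 0 < r \<Longrightarrow> r < R \<Longrightarrow> f' r \<ge> 0"
  shows "f R \<ge> 0"
proof -
  have "f 0 \<le> f R"
    by (rule DERIV_nonneg_imp_increasing_open[OF assms(1) _ assms(3)]) (use assms in blast)
  then show ?thesis using assms by simp
qed

lemma W_pos:
  assumes "m > 0" "R > 0" shows "W m R > 0"
  using DERIV_pos_imp_increasing_open[of 0 R "W m"] assms continuous_on_W W_deriv w_pos by force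

lemma W_nonneg: "m > 0 \<Longrightarrow> R \<ge> 0 \<Longrightarrow> W m R \<ge> 0"
  using W_pos[of m R] by (cases "R = 0") auto

lemma W_le:
  assumes "m > 0" "r \<in> {0<..R}"
  shows "W m r \<le> r * w m r * exp (R\<^sup>2 / 2)"
proof -
  obtain t where t: "0 < t" "t < r" "W m r - W m 0 = (r - 0) * w m t"
  proof -
    have "\<exists>l z. 0 < z \<and> z < r \<and> DERIV (W m) z :> l \<and> W m r - W m 0 = (r - 0) * l"
      by (rule MVT) (use assms continuous_on_W W_deriv in \<open>force simp: real_differentiable_def\<close>)+
    then show ?thesis using that W_deriv[OF assms(1)] DERIV_unique by blast
  qed
  have "w m t \<le> t powr m" by (rule w_le)
  also have "\<dots> \<le> r powr m" using t assms by (intro powr_mono2) auto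
  also have "\<dots> \<le> w m r * exp (R\<^sup>2 / 2)" using assms by (intro le_w) auto
  finally show ?thesis using t assms by (simp add: mult.assoc mult_left_mono)
qed

section \<open>An explicit minimizer\<close>

context
  fixes m :: real
begin

text \<open>With \<open>s = multiplier c\<close>, \<open>v = extremal c\<close> and \<open>v' = extremal' c\<close>, the function \<open>s\<close> is the solution of
  \<open>r s' + (m - r^2) s = 1 - c r\<close> that is bounded at \<open>0\<close>. This equation is what remains of the
  Euler equation after the integration \<open>r s = v + c\<close>; the definition of \<open>extremal'\<close> is
  \<open>(m - 1) s = 1 + T v\<close> solved for \<open>v'\<close>.

  The flux \<open>(v' - s) w\<close> of the Euler equation equals \<open>fluxY - c fluxZ\<close>, so \<open>free_const R\<close> is the
  constant for which the natural boundary condition holds at \<open>R\<close>. For this constant the value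
  \<open>v(R)\<close> is \<open>fluxP R / fluxZ R\<close>, and \<open>v(R) + R s(R)\<close> is \<open>(2 fluxP R + fluxY R) / fluxZ R\<close>.\<close>

definition fluxY where "fluxY r = (r\<^sup>2 - m) * W (m - 1) r + w m r"
definition fluxZ where "fluxZ r = (r\<^sup>2 - m) * W m r + r * w m r"
definition fluxP where "fluxP r = m * W (m - 1) r - w m r - r * W m r"

definition multiplier where "multiplier c r = (W (m - 1) r - c * W m r) / w m r"
definition extremal where "extremal c r = r * multiplier c r - c"
definition extremal' where "extremal' c r = 1 - (m - 1) * multiplier c r + r * extremal c r"
definition free_const where "free_const R = fluxY R / fluxZ R"

text \<open>The closed form of the integral of \<open>s w\<close> over \<open>(0,R)\<close>, for the constant \<open>free_const R\<close>.\<close>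

definition total_value where "total_value R = R * W (m - 1) R - W m R + free_const R * fluxP R"
definition min_value where "min_value R = total_value R / W m R"

context
  assumes m: "m > 1"
begin

lemmas mpos = order.strict_trans[OF zero_less_one m] iffD2[OF diff_gt_0_iff_gt m]

lemma W1_deriv: "r > 0 \<Longrightarrow> (W (m - 1) has_real_derivative w m r / r) (at r)"
  using W_deriv[OF mpos(2), of r] by (simp only: w_minus_one)

lemmas primitive_derivs = W1_deriv W_deriv[OF mpos(1)] w_deriv[of _ m]
lemmas primitive_conts = continuous_on_W[OF mpos(1)] continuous_on_W[OF mpos(2)]
  continuous_on_w[OF mpos(1)]

lemma fluxY_deriv: "r > 0 \<Longrightarrow> (fluxY has_real_derivative 2 * r * W (m - 1) r) (at r)"
  unfolding fluxY_def[abs_def]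
  by (auto intro!: derivative_eq_intros primitive_derivs simp: field_simps power2_eq_square)

lemma fluxZ_deriv: "r > 0 \<Longrightarrow> (fluxZ has_real_derivative 2 * r * W m r + w m r) (at r)"
  unfolding fluxZ_def[abs_def]
  by (auto intro!: derivative_eq_intros primitive_derivs simp: field_simps power2_eq_square)

lemma fluxP_deriv: "r > 0 \<Longrightarrow> (fluxP has_real_derivative - W m r) (at r)"
  unfolding fluxP_def[abs_def]
  by (auto intro!: derivative_eq_intros primitive_derivs simp: field_simps power2_eq_square)

lemma flux_at_0: "fluxY 0 = 0" "fluxZ 0 = 0" "fluxP 0 = 0"
  by (simp_all add: fluxY_def fluxZ_def fluxP_def)

lemma flux_cont: "continuous_on {0..R} fluxY" "continuous_on {0..R} fluxZ" "continuous_on {0..R} fluxP"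
  unfolding fluxY_def[abs_def] fluxZ_def[abs_def] fluxP_def[abs_def]
  by (auto intro!: continuous_intros primitive_conts)

lemma fluxZ_pos:
  assumes "R > 0" shows "fluxZ R > 0"
proof -
  have "2 * r * W m r + w m r > 0" if "r > 0" for r
    using W_pos[OF mpos(1) that] w_pos[OF that, of m] that by (simp add: add_pos_pos)
  then show ?thesis
    using DERIV_pos_imp_increasing_open[of 0 R fluxZ] fluxZ_deriv flux_cont assms flux_at_0 by force
qed

text \<open>That is, \<open>v(R) \<le> 0\<close> for the minimizer.\<close>

lemma fluxP_nonpos:
  assumes "R > 0" shows "fluxP R \<le> 0"
proof -
  have "- fluxP R \<ge> 0"
    by (rule nonneg_of_deriv_nonneg[where f' = "W m"])
       (use assms flux_at_0 flux_cont in
         \<open>auto intro!: continuous_intros W_nonneg[OF mpos(1)] derivative_eq_intros fluxP_deriv\<close>)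
  then show ?thesis by simp
qed

lemma first_moment_W: "r > 0 \<Longrightarrow> ((\<lambda>r. r * W (m - 1) r - W m r) has_real_derivative W (m - 1) r) (at r)"
  by (auto intro!: derivative_eq_intros primitive_derivs)

lemma W_le_mult_W1: "R > 0 \<Longrightarrow> W m R \<le> R * W (m - 1) R"
  using nonneg_of_deriv_nonneg[of R "\<lambda>r. r * W (m - 1) r - W m r" "W (m - 1)"]
  by (force intro!: continuous_intros primitive_conts first_moment_W W_nonneg[OF mpos(2)])

text \<open>That is, \<open>v(R) + R s(R) \<ge> 0\<close> for the minimizer. The derivative of the left-hand side is twice
  \<open>R W (m - 1) R - W m R\<close>, the integral of \<open>(R - t) w t / t\<close>.\<close>

lemma flux_sum_nonneg:
  assumes "R > 0" shows "2 * fluxP R + fluxY R \<ge> 0"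
  by (rule nonneg_of_deriv_nonneg[where f' = "\<lambda>r. 2 * (r * W (m - 1) r - W m r)"])
     (use assms flux_at_0 flux_cont W_le_mult_W1 in
       \<open>auto intro!: continuous_intros derivative_eq_intros fluxP_deriv fluxY_deriv simp: algebra_simps\<close>)

text \<open>This identity and the next one make the derivative of \<open>free_const\<close> a multiple of the
  nonnegative quantity \<open>2 fluxP + fluxY\<close>.\<close>

lemma flux_wronskian:
  "W (m - 1) r * fluxZ r - W m r * fluxY r = w m r * (r * W (m - 1) r - W m r)"
  by (simp add: fluxY_def fluxZ_def algebra_simps)

lemma flux_sum: "fluxP r + fluxY r = r * (r * W (m - 1) r - W m r)"
  by (simp add: fluxY_def fluxP_def algebra_simps power2_eq_square)

lemma free_const_deriv:
  assumes "r > 0"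
  shows "(free_const has_real_derivative w m r * (2 * fluxP r + fluxY r) / (fluxZ r)\<^sup>2) (at r)"
proof -
  have "(free_const has_real_derivative
      (2 * r * W (m - 1) r * fluxZ r - fluxY r * (2 * r * W m r + w m r)) / (fluxZ r)\<^sup>2) (at r)"
    unfolding free_const_def[abs_def] using fluxZ_pos[OF assms]
    by (auto intro!: derivative_eq_intros fluxY_deriv fluxZ_deriv assms simp: power2_eq_square)
  moreover have "2 * r * W (m - 1) r * fluxZ r - fluxY r * (2 * r * W m r + w m r)
      = w m r * (2 * fluxP r + fluxY r)"
  proof -
    have "2 * r * W (m - 1) r * fluxZ r - fluxY r * (2 * r * W m r + w m r)
        = 2 * r * (W (m - 1) r * fluxZ r - W m r * fluxY r) - fluxY r * w m r"
      by (simp add: algebra_simps)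
    also have "\<dots> = w m r * (2 * (r * (r * W (m - 1) r - W m r)) - fluxY r)"
      unfolding flux_wronskian by (simp add: algebra_simps)
    also have "\<dots> = w m r * (2 * fluxP r + fluxY r)"
      by (simp flip: flux_sum)
    finally show ?thesis .
  qed
  ultimately show ?thesis by simp
qed

lemma free_const_mono:
  assumes "0 < r" "r \<le> R" shows "free_const r \<le> free_const R"
proof (rule DERIV_nonneg_imp_nondecreasing[OF assms(2)])
  fix x assume "r \<le> x" "x \<le> R"
  with assms have "x > 0" by simp
  then show "\<exists>y. DERIV free_const x :> y \<and> y \<ge> 0"
    using free_const_deriv flux_sum_nonneg w_pos[of x m] by (intro exI conjI) (auto intro!: divide_nonneg_nonneg mult_nonneg_nonneg simp: less_imp_le)
qed

lemma multiplier_deriv: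
  assumes "r > 0"
  shows "(multiplier c has_real_derivative (fluxY r - c * fluxZ r) / (r * w m r)) (at r)"
proof -
  have w0: "w m r > 0" by (rule w_pos[OF assms])
  have "(multiplier c has_real_derivative ((w m r / r - c * w m r) * w m r
      - (W (m - 1) r - c * W m r) * ((m / r - r) * w m r)) / (w m r * w m r)) (at r)"
    unfolding multiplier_def[abs_def] using w0
    by (intro DERIV_divide DERIV_diff DERIV_cmult primitive_derivs assms) auto
  moreover have "((w m r / r - c * w m r) * w m r - (W (m - 1) r - c * W m r) * ((m / r - r) * w m r))
      = w m r * ((fluxY r - c * fluxZ r) / r)"
    using assms by (simp add: fluxY_def fluxZ_def field_simps power2_eq_square)
  ultimately show ?thesis using w0 by simp
qed

text \<open>The derivative of \<open>multiplier (free_const R)\<close> at \<open>r\<close> is a positive multiple of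
  \<open>free_const r - free_const R\<close>, hence nonpositive for \<open>r \<le> R\<close>.\<close>

lemma multiplier_antimono:
  assumes "0 < r" "r \<le> R" shows "multiplier (free_const R) R \<le> multiplier (free_const R) r"
proof (rule DERIV_nonpos_imp_nonincreasing[OF assms(2)])
  fix x assume x: "r \<le> x" "x \<le> R"
  with assms have x0: "x > 0" by simp
  have "fluxY x - free_const R * fluxZ x = (free_const x - free_const R) * fluxZ x"
    using fluxZ_pos[OF x0] by (simp add: free_const_def field_simps)
  also have "\<dots> \<le> 0"
    using free_const_mono[OF x0 x(2)] fluxZ_pos[OF x0] by (simp add: mult_le_0_iff)
  finally have "(fluxY x - free_const R * fluxZ x) / (x * w m x) \<le> 0"
    using w_pos[OF x0, of m] x0 by (simp add: divide_nonpos_pos)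
  then show "\<exists>y. DERIV (multiplier (free_const R)) x :> y \<and> y \<le> 0" using multiplier_deriv[OF x0] by blast
qed

lemma multiplier_integral:
  assumes "R > 0"
  shows "(\<integral>r. multiplier (free_const R) r * w m r \<partial>leb_ivl R) = total_value R"
proof -
  have "(\<integral>r. multiplier (free_const R) r * w m r \<partial>leb_ivl R) = (\<integral>r. W (m - 1) r - free_const R * W m r \<partial>leb_ivl R)"
    using w_pos[of _ m] by (intro Bochner_Integration.integral_cong) (auto simp: multiplier_def space_restrict_space, force)
  also have "\<dots> = (R * W (m - 1) R - W m R + free_const R * fluxP R) - (0 * W (m - 1) 0 - W m 0 + free_const R * fluxP 0)"
    by (rule leb_ivl_FTC)
       (use assms flux_cont in \<open>auto intro!: continuous_intros primitive_conts derivative_eq_intros primitive_derivs fluxP_deriv\<close>)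
  finally show ?thesis by (simp add: flux_at_0 total_value_def)
qed

text \<open>The average of a nonincreasing function dominates its value at the right endpoint.\<close>

lemma multiplier_le_average:
  assumes "R > 0"
  shows "multiplier (free_const R) R * W m R \<le> total_value R"
proof -
  let ?s = "multiplier (free_const R)"
  define t where "t = ?s R"
  have "0 \<le> R * W (m - 1) R - W m R + free_const R * fluxP R - t * W m R"
  proof (rule nonneg_of_deriv_nonneg[where f = "\<lambda>r. r * W (m - 1) r - W m r + free_const R * fluxP r - t * W m r"
        and f' = "\<lambda>r. (?s r - t) * w m r"])
    fix r assume r: "0 < r" "r < R"
    show "((\<lambda>r. r * W (m - 1) r - W m r + free_const R * fluxP r - t * W m r)
        has_real_derivative (?s r - t) * w m r) (at r)"
      using r w_pos[of r m]
      by (auto intro!: derivative_eq_intros primitive_derivs fluxP_deriv simp: multiplier_def diff_divide_distrib algebra_simps)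
    show "0 \<le> (?s r - t) * w m r"
      using multiplier_antimono[of r R] r w_pos[of r m] by (simp add: t_def)
  qed (use assms flux_at_0 flux_cont in \<open>auto intro!: continuous_intros primitive_conts\<close>)
  then show ?thesis by (simp add: total_value_def t_def)
qed

text \<open>The factor of the weight is \<open>s(R) + v(R) (v(R) + R s(R))\<close>. By the boundary condition \<open>v' = s\<close> this is the energy
  density of the minimizer at the endpoint, as it has to be for a minimum: the first-order change of
  the minimizer costs nothing.\<close>

lemma total_value_deriv:
  assumes "R > 0"
  shows "(total_value has_real_derivative
    w m R * (multiplier (free_const R) R + fluxP R * (2 * fluxP R + fluxY R) / (fluxZ R)\<^sup>2)) (at R)"
proof -
  have "(total_value has_real_derivative W (m - 1) R + (w m R * (2 * fluxP R + fluxY R) / (fluxZ R)\<^sup>2 * fluxP R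
      + - W m R * free_const R)) (at R)"
    unfolding total_value_def[abs_def]
    by (intro DERIV_add DERIV_mult first_moment_W fluxP_deriv free_const_deriv assms)
  moreover have "W (m - 1) R - W m R * free_const R = w m R * multiplier (free_const R) R"
    using w_pos[OF assms, of m] by (simp add: multiplier_def mult.commute)
  ultimately show ?thesis by (simp add: algebra_simps)
qed

text \<open>An average decreases when the density entering at the endpoint lies below it. Here the density is at most
  \<open>s(R)\<close> by the two sign lemmas, and \<open>s(R)\<close> is at most the average.\<close>

lemma min_value_antimono:
  assumes "0 < R1" "R1 \<le> R2"
  shows "min_value R2 \<le> min_value R1"
proof (rule DERIV_nonpos_imp_nonincreasing[OF assms(2)])
  fix R assume "R1 \<le> R" "R \<le> R2"
  with assms have R: "R > 0" by simp
  let ?D = "w m R * (multiplier (free_const R) R + fluxP R * (2 * fluxP R + fluxY R) / (fluxZ R)\<^sup>2)"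
  have pos: "W m R > 0" "w m R > 0" using W_pos[OF mpos(1) R] w_pos[OF R] by auto
  have "fluxP R * (2 * fluxP R + fluxY R) / (fluxZ R)\<^sup>2 \<le> 0"
    using fluxP_nonpos[OF R] flux_sum_nonneg[OF R] by (simp add: divide_nonpos_nonneg mult_nonpos_nonneg)
  then have "?D * W m R \<le> (w m R * multiplier (free_const R) R) * W m R"
    using pos by (intro mult_right_mono mult_left_mono) auto
  also have "\<dots> \<le> w m R * total_value R"
    using multiplier_le_average[OF R] pos by (simp add: mult.assoc)
  finally have "(?D * W m R - total_value R * w m R) / (W m R * W m R) \<le> 0"
    using pos by (simp add: divide_nonpos_pos mult.commute)
  moreover have "(min_value has_real_derivative (?D * W m R - total_value R * w m R) / (W m R * W m R)) (at R)"
    unfolding min_value_def[abs_def] using pos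
    by (intro DERIV_divide total_value_deriv W_deriv[OF mpos(1)] R) auto
  ultimately show "\<exists>y. DERIV min_value R :> y \<and> y \<le> 0" by blast
qed

lemma extremal_deriv:
  assumes "r > 0" shows "(extremal c has_real_derivative extremal' c r) (at r)"
proof -
  have "(extremal c has_real_derivative multiplier c r + (fluxY r - c * fluxZ r) / w m r) (at r)"
    unfolding extremal_def[abs_def] using assms by (auto intro!: derivative_eq_intros multiplier_deriv)
  moreover have "multiplier c r + (fluxY r - c * fluxZ r) / w m r = extremal' c r"
    using w_pos[OF assms, of m] by (simp add: extremal'_def extremal_def multiplier_def fluxY_def fluxZ_def field_simps power2_eq_square)
  ultimately show ?thesis by simp
qed

text \<open>The next two identities say that \<open>fluxY - c fluxZ\<close> is the flux \<open>(v' - s) w\<close> and that its derivative is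
  \<open>(v + r s) w\<close>, which is the Euler equation.\<close>

lemma flux_eq: "r > 0 \<Longrightarrow> fluxY r - c * fluxZ r = (extremal' c r - multiplier c r) * w m r"
  using w_pos[of r m] by (simp add: extremal'_def extremal_def multiplier_def fluxY_def fluxZ_def field_simps power2_eq_square)

lemma flux'_eq: "r > 0 \<Longrightarrow> 2 * r * W (m - 1) r - c * (2 * r * W m r + w m r) = (extremal c r + r * multiplier c r) * w m r"
  using w_pos[of r m] by (simp add: extremal_def multiplier_def field_simps)

text \<open>Near \<open>0\<close> both \<open>W (m - 1)\<close> and \<open>W m\<close> are bounded by a multiple of \<open>w m\<close>, which makes the quotient
  bounded.\<close>

lemma multiplier_bounded:
  obtains B where "B \<ge> 0" "\<And>r. r \<in> {0<..<R} \<Longrightarrow> \<bar>multiplier c r\<bar> \<le> B"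
    "\<And>r. r \<in> {0<..<R} \<Longrightarrow> \<bar>extremal c r\<bar> \<le> B" "\<And>r. r \<in> {0<..<R} \<Longrightarrow> \<bar>extremal' c r\<bar> \<le> B"
proof -
  define K where "K = exp (R\<^sup>2 / 2) * (1 + \<bar>c\<bar> * \<bar>R\<bar>)"
  define L where "L = \<bar>R\<bar> * K + \<bar>c\<bar>"
  have K0: "K \<ge> 0" "L \<ge> 0" by (auto simp: K_def L_def)
  have s: "\<bar>multiplier c r\<bar> \<le> K" if r: "r \<in> {0<..<R}" for r
  proof -
    have w0: "w m r > 0" using r w_pos by auto
    have "W (m - 1) r \<le> r * (w m r / r) * exp (R\<^sup>2 / 2)"
      using W_le[OF mpos(2), of r R] w_minus_one[of r m] r by simp
    then have 1: "0 \<le> W (m - 1) r" "W (m - 1) r \<le> w m r * exp (R\<^sup>2 / 2)"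
      using W_nonneg[OF mpos(2), of r] r by auto
    have "W m r \<le> r * w m r * exp (R\<^sup>2 / 2)" using W_le[OF mpos(1), of r R] r by simp
    also have "\<dots> \<le> R * w m r * exp (R\<^sup>2 / 2)" using r w0 by (intro mult_right_mono) auto
    finally have 2: "0 \<le> W m r" "W m r \<le> R * w m r * exp (R\<^sup>2 / 2)"
      using W_nonneg[OF mpos(1), of r] r by auto
    have "\<bar>W (m - 1) r - c * W m r\<bar> \<le> W (m - 1) r + \<bar>c\<bar> * W m r"
      using 1 2 abs_triangle_ineq4[of "W (m - 1) r" "c * W m r"] by (simp add: abs_mult)
    also have "\<dots> \<le> w m r * exp (R\<^sup>2 / 2) + \<bar>c\<bar> * (R * w m r * exp (R\<^sup>2 / 2))"
      using 1 2 by (intro add_mono mult_left_mono) auto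
    also have "\<dots> = K * w m r" using r by (simp add: K_def algebra_simps)
    finally show ?thesis using w0 by (simp add: multiplier_def abs_mult pos_divide_le_eq)
  qed
  have v: "\<bar>extremal c r\<bar> \<le> L" if r: "r \<in> {0<..<R}" for r
  proof -
    have "\<bar>extremal c r\<bar> \<le> \<bar>r\<bar> * \<bar>multiplier c r\<bar> + \<bar>c\<bar>"
      unfolding extremal_def using abs_triangle_ineq4[of "r * multiplier c r" c] by (simp add: abs_mult)
    also have "\<dots> \<le> L" unfolding L_def using r s[OF r] by (intro add_mono mult_mono) auto
    finally show ?thesis .
  qed
  have p: "\<bar>extremal' c r\<bar> \<le> 1 + (m - 1) * K + \<bar>R\<bar> * L" if r: "r \<in> {0<..<R}" for r
  proof -
    have "\<bar>extremal' c r\<bar> \<le> 1 + \<bar>(m - 1) * multiplier c r\<bar> + \<bar>r * extremal c r\<bar>"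
      unfolding extremal'_def by linarith
    also have "\<dots> \<le> 1 + (m - 1) * K + \<bar>R\<bar> * L"
      unfolding abs_mult using r s[OF r] v[OF r] m by (intro add_mono mult_mono) auto
    finally show ?thesis .
  qed
  have nn: "(m - 1) * K \<ge> 0" "\<bar>R\<bar> * L \<ge> 0" using K0 m by auto
  show ?thesis
    by (rule that[of "K + L + (1 + (m - 1) * K + \<bar>R\<bar> * L)"])
       (use K0 nn s v p in \<open>force+\<close>)
qed

text \<open>For \<open>c = free_const R\<close> the flux vanishes at both endpoints while its derivative is bounded by a multiple
  of the weight. The mean value theorem at the nearer endpoint gives the linear vanishing that
  \<open>weak_integration_by_parts\<close> asks for.\<close>

lemma flux_bounds:
  assumes R: "R > 0"
  defines "F \<equiv> \<lambda>r. fluxY r - free_const R * fluxZ r"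
  obtains B where "\<And>r. r \<in> {0<..<R} \<Longrightarrow> \<bar>F r\<bar> \<le> r * (B * w m r)"
    "\<And>r. r \<in> {0<..<R} \<Longrightarrow> \<bar>F r\<bar> \<le> (R - r) * (B * w m r)"
proof -
  define f where "f r = 2 * r * W (m - 1) r - free_const R * (2 * r * W m r + w m r)" for r
  obtain A where A: "A \<ge> 0" "\<And>r. r \<in> {0<..<R} \<Longrightarrow> \<bar>multiplier (free_const R) r\<bar> \<le> A"
    "\<And>r. r \<in> {0<..<R} \<Longrightarrow> \<bar>extremal (free_const R) r\<bar> \<le> A"
    using multiplier_bounded[of R "free_const R"] by metis
  define A' where "A' = A + R * A"
  have A': "A' \<ge> 0" using A R by (simp add: A'_def)
  have f: "\<bar>f r\<bar> \<le> A' * r powr m" if r: "r \<in> {0<..<R}" for r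
  proof -
    have "\<bar>extremal (free_const R) r + r * multiplier (free_const R) r\<bar> \<le> \<bar>extremal (free_const R) r\<bar> + r * \<bar>multiplier (free_const R) r\<bar>"
      using r abs_triangle_ineq[of "extremal (free_const R) r" "r * multiplier (free_const R) r"] by (simp add: abs_mult)
    also have "\<dots> \<le> A'" unfolding A'_def using r A by (intro add_mono mult_mono) auto
    finally have "\<bar>extremal (free_const R) r + r * multiplier (free_const R) r\<bar> * w m r \<le> A' * r powr m"
      using w_le[of m r] w_pos[of r m] r A' by (intro mult_mono) auto
    then show ?thesis using flux'_eq[of r "free_const R"] w_pos[of r m] r by (simp add: f_def abs_mult)
  qed
  have Fd: "(F has_real_derivative f r) (at r)" if "r > 0" for r
    unfolding F_def f_def using that by (auto intro!: derivative_eq_intros fluxY_deriv fluxZ_deriv)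
  have Fc: "continuous_on {0..R} F" unfolding F_def by (auto intro!: continuous_intros flux_cont)
  have F0: "F 0 = 0" "F R = 0" using flux_at_0 fluxZ_pos[OF R] by (auto simp: F_def free_const_def)
  have mv: "\<exists>t. x < t \<and> t < y \<and> F y - F x = (y - x) * f t" if "0 \<le> x" "x < y" "y \<le> R" for x y
  proof -
    have "\<exists>l z. x < z \<and> z < y \<and> DERIV F z :> l \<and> F y - F x = (y - x) * l"
    proof (rule MVT[OF that(2)])
      show "continuous_on {x..y} F" by (rule continuous_on_subset[OF Fc]) (use that in auto)
      show "F differentiable at z" if "x < z" "z < y" for z
        using Fd[of z] that \<open>0 \<le> x\<close> by (auto simp: real_differentiable_def)
    qed
    then obtain l z where z: "x < z" "z < y" "DERIV F z :> l" "F y - F x = (y - x) * l" by blast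
    moreover have "l = f z" using DERIV_unique[OF z(3) Fd[of z]] z that by auto
    ultimately show ?thesis by blast
  qed
  define B where "B = A' * 2 powr m * exp (R\<^sup>2 / 2)"
  have B: "A' * exp (R\<^sup>2 / 2) \<le> B" "B \<ge> 0"
    using A' m mult_left_mono[of 1 "2 powr m" "A' * exp (R\<^sup>2 / 2)"]
    by (auto simp: B_def ge_one_powr_ge_zero mult.commute mult.left_commute)
  have left: "\<bar>F r\<bar> \<le> r * (B * w m r)" if r: "r \<in> {0<..<R}" for r
  proof -
    obtain t where t: "0 < t" "t < r" "F r = r * f t" using mv[of 0 r] r F0 by auto
    have "\<bar>f t\<bar> \<le> A' * t powr m" using t r by (intro f) auto
    also have "\<dots> \<le> A' * r powr m" using t A' m by (intro mult_left_mono powr_mono2) auto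
    also have "\<dots> \<le> A' * (w m r * exp (R\<^sup>2 / 2))" using r A' by (intro mult_left_mono le_w) auto
    also have "\<dots> \<le> B * w m r"
      using mult_right_mono[OF B(1), of "w m r"] w_pos[of r m] r by (simp add: mult_ac)
    finally show ?thesis using t r by (simp add: abs_mult mult_left_mono)
  qed
  have right: "\<bar>F r\<bar> \<le> (R - r) * (B * w m r)" if r: "r \<in> {0<..<R}" for r
  proof (cases "r \<le> R / 2")
    case True
    \<comment> \<open>In the left half \<open>r \<le> R - r\<close>, so the bound from the left endpoint suffices.\<close>
    have "r * (B * w m r) \<le> (R - r) * (B * w m r)"
      using True r B w_pos[of r m] by (intro mult_right_mono) auto
    with left[OF r] show ?thesis by linarith
  next
    case False
    obtain t where t: "r < t" "t < R" "- F r = (R - r) * f t" using mv[of r R] r F0 by auto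
    have "\<bar>f t\<bar> \<le> A' * t powr m" using t r by (intro f) auto
    \<comment> \<open>In the right half \<open>t < R < 2 r\<close>, which accounts for the factor \<open>2 powr m\<close> in \<open>B\<close>.\<close>
    also have "\<dots> \<le> A' * (2 * r) powr m" using t r False A' m by (intro mult_left_mono powr_mono2) auto
    also have "\<dots> = A' * 2 powr m * r powr m" using r by (simp add: powr_mult)
    also have "\<dots> \<le> A' * 2 powr m * (w m r * exp (R\<^sup>2 / 2))" using r A' by (intro mult_left_mono le_w) auto
    also have "\<dots> = B * w m r" by (simp add: B_def mult_ac)
    finally have "\<bar>f t\<bar> \<le> B * w m r" .
    moreover have "\<bar>F r\<bar> = (R - r) * \<bar>f t\<bar>" using t r by (metis abs_minus_cancel abs_mult abs_of_pos diff_gt_0_iff_gt greaterThanLessThan_iff)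
    ultimately show ?thesis using r by (simp add: mult_left_mono)
  qed
  show ?thesis by (rule that[OF left right])
qed

text \<open>All ingredients are smooth because their derivatives are again polynomials in \<open>r\<close>, \<open>1/r\<close>, the weight and its
  primitives.\<close>

lemma diffs_on_flux: "diffs_on n {0<..<R} (\<lambda>r. fluxY r - c * fluxZ r)"
proof -
  have inv: "diffs_on n {0<..<R} inverse" for n
  proof (induction n)
    case (Suc n)
    show ?case
    proof (rule diffs_on_Suc_I)
      show "(inverse has_real_derivative (-1) * (inverse x * inverse x)) (at x)" if "x \<in> {0<..<R}" for x
        using that by (auto intro!: derivative_eq_intros)
    qed (intro diffs_on_mult diffs_on_const Suc)
  qed simp
  have dw: "diffs_on n {0<..<R} (w m)" for n
  proof (induction n)
    case (Suc n)
    show ?case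
    proof (rule diffs_on_Suc_I)
      show "(w m has_real_derivative (m * inverse x - x) * w m x) (at x)" if "x \<in> {0<..<R}" for x
        using w_deriv[of x m] that by (simp add: divide_inverse)
    qed (intro diffs_on_mult diffs_on_diff diffs_on_const diffs_on_ident inv Suc)
  qed simp
  have dW: "diffs_on n {0<..<R} (W m)"
    by (rule diffs_on_SucD, rule diffs_on_Suc_I[OF _ dw]) (use W_deriv[OF mpos(1)] in auto)
  have "diffs_on n {0<..<R} (\<lambda>r. w m r * inverse r)" by (intro diffs_on_mult dw inv)
  then have dX: "diffs_on n {0<..<R} (W (m - 1))"
    by (rule diffs_on_SucD[OF diffs_on_Suc_I, rotated]) (use W1_deriv in \<open>auto simp: divide_inverse\<close>)
  show ?thesis
    unfolding fluxY_def fluxZ_def power2_eq_square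
    by (intro diffs_on_diff diffs_on_add diffs_on_mult diffs_on_const diffs_on_ident dw dW dX)
qed

end

end

section \<open>Square integrable functions\<close>

lemma L2_measurable: "f \<in> L2 M \<Longrightarrow> f \<in> borel_measurable M"
  by (simp add: L2_def)

lemma L2_mult_integrable:
  assumes "f \<in> L2 M" "g \<in> L2 M" shows "integrable M (\<lambda>x. f x * g x)"
proof (rule Bochner_Integration.integrable_bound[where f = "\<lambda>x. (f x)\<^sup>2 + (g x)\<^sup>2"])
  show "integrable M (\<lambda>x. (f x)\<^sup>2 + (g x)\<^sup>2)" using assms by (auto simp: L2_def)
  show "(\<lambda>x. f x * g x) \<in> borel_measurable M" using assms by (auto simp: L2_def)
  have "\<bar>a * b\<bar> \<le> \<bar>a\<^sup>2 + b\<^sup>2\<bar>" for a b :: real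
  proof -
    have "2 * (\<bar>a\<bar> * \<bar>b\<bar>) \<le> a\<^sup>2 + b\<^sup>2" using sum_squares_bound[of "\<bar>a\<bar>" "\<bar>b\<bar>"] by simp
    moreover have "0 \<le> \<bar>a\<bar> * \<bar>b\<bar>" by simp
    ultimately have "\<bar>a\<bar> * \<bar>b\<bar> \<le> a\<^sup>2 + b\<^sup>2" by linarith
    then show ?thesis by (simp add: abs_mult)
  qed
  then show "AE x in M. norm (f x * g x) \<le> norm ((f x)\<^sup>2 + (g x)\<^sup>2)" by simp
qed

lemma L2_power2_integrable: "f \<in> L2 M \<Longrightarrow> integrable M (\<lambda>x. (f x)\<^sup>2)"
  by (simp add: L2_def)

lemma L2_cmult: "f \<in> L2 M \<Longrightarrow> (\<lambda>x. c * f x) \<in> L2 M"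
  by (auto simp: L2_def power_mult_distrib)

lemma L2_add:
  assumes "f \<in> L2 M" "g \<in> L2 M" shows "(\<lambda>x. f x + g x) \<in> L2 M"
proof -
  have "integrable M (\<lambda>x. (f x)\<^sup>2 + (g x)\<^sup>2 + 2 * (f x * g x))"
    using assms L2_mult_integrable[OF assms] by (auto simp: L2_def)
  then show ?thesis using assms by (auto simp: L2_def power2_sum algebra_simps)
qed

lemma L2_diff: "f \<in> L2 M \<Longrightarrow> g \<in> L2 M \<Longrightarrow> (\<lambda>x. f x - g x) \<in> L2 M"
  using L2_add[of f M "\<lambda>x. (-1) * g x"] L2_cmult[of g M "-1"] by simp

lemma L2_bounded_mult:
  assumes "f \<in> L2 M" "h \<in> borel_measurable M" "\<And>x. x \<in> space M \<Longrightarrow> \<bar>h x\<bar> \<le> B"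
  shows "(\<lambda>x. h x * f x) \<in> L2 M"
proof -
  have "integrable M (\<lambda>x. B\<^sup>2 * (f x)\<^sup>2)" using assms by (auto simp: L2_def)
  then have "integrable M (\<lambda>x. (h x * f x)\<^sup>2)"
  proof (rule Bochner_Integration.integrable_bound)
    show "(\<lambda>x. (h x * f x)\<^sup>2) \<in> borel_measurable M" using assms by (auto simp: L2_def)
    show "AE x in M. norm ((h x * f x)\<^sup>2) \<le> norm (B\<^sup>2 * (f x)\<^sup>2)"
    proof (rule AE_I2)
      fix x assume "x \<in> space M"
      then have "(h x)\<^sup>2 \<le> B\<^sup>2" using power_mono[OF assms(3), of x 2] by simp
      then show "norm ((h x * f x)\<^sup>2) \<le> norm (B\<^sup>2 * (f x)\<^sup>2)"
        by (simp add: power_mult_distrib mult_right_mono)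
    qed
  qed
  then show ?thesis using assms by (auto simp: L2_def)
qed

context
  fixes m R :: real
  assumes m: "m > 1" and R: "R > 0"
begin

lemma mpos': "m > 0" using m by simp

lemma space_mu: "space (mu m R) = {0<..<R}"
  by (simp add: mu_def space_restrict_space)

lemma borel_measurable_mu: "borel_measurable (mu m R) = borel_measurable (leb_ivl R)"
  by (rule measurable_cong_sets) (simp_all add: mu_def)

lemma measurable_continuous:
  "continuous_on {0<..<R} f \<Longrightarrow> f \<in> borel_measurable (mu m R)" for f :: "real \<Rightarrow> real"
  unfolding borel_measurable_mu by (rule leb_ivl_measurable_continuous)

lemma weight_measurable [measurable]: "w m \<in> borel_measurable (leb_ivl R)"
  using measurable_continuous[OF continuous_on_w[OF mpos', of "{0<..<R}"]]
  unfolding borel_measurable_mu by force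

lemma W_R_pos: "W m R > 0" by (rule W_pos[OF mpos' R])

lemma integrable_mu_iff:
  fixes f :: "real \<Rightarrow> real"
  assumes "f \<in> borel_measurable (leb_ivl R)"
  shows "integrable (mu m R) f \<longleftrightarrow> integrable (leb_ivl R) (\<lambda>r. f r * w m r)"
proof -
  have "integrable (mu m R) f \<longleftrightarrow> integrable (leb_ivl R) (\<lambda>r. (w m r / W m R) *\<^sub>R f r)"
    unfolding mu_def
    by (rule integrable_density)
       (use assms W_R_pos w_pos[of _ m] in \<open>auto intro!: AE_I2 simp: space_restrict_space less_imp_le\<close>)
  also have "(\<lambda>r. (w m r / W m R) *\<^sub>R f r) = (\<lambda>r. (1 / W m R) * (f r * w m r))" by auto
  finally show ?thesis using W_R_pos by (simp del: times_divide_eq_left)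
qed

lemma integral_mu:
  fixes f :: "real \<Rightarrow> real"
  assumes "f \<in> borel_measurable (leb_ivl R)"
  shows "(\<integral>r. f r \<partial>mu m R) = (\<integral>r. f r * w m r \<partial>leb_ivl R) / W m R"
proof -
  have "(\<integral>r. f r \<partial>mu m R) = (\<integral>r. (w m r / W m R) *\<^sub>R f r \<partial>leb_ivl R)"
    unfolding mu_def
    by (rule integral_density)
       (use assms W_R_pos w_pos[of _ m] in \<open>auto intro!: AE_I2 simp: space_restrict_space less_imp_le\<close>)
  also have "\<dots> = (\<integral>r. (f r * w m r) / W m R \<partial>leb_ivl R)"
    by (simp add: mult.commute)
  finally show ?thesis by simp
qed

lemma integrable_w_measure_iff:
  fixes f :: "real \<Rightarrow> real"
  assumes "f \<in> borel_measurable (leb_ivl R)"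
  shows "integrable (w_measure m R) f \<longleftrightarrow> integrable (mu m R) f"
proof -
  have "integrable (w_measure m R) f \<longleftrightarrow> integrable (leb_ivl R) (\<lambda>r. w m r *\<^sub>R f r)"
    unfolding w_measure_def
    by (rule integrable_density)
       (use assms w_pos[of _ m] in \<open>auto intro!: AE_I2 simp: space_restrict_space less_imp_le\<close>)
  then show ?thesis unfolding integrable_mu_iff[OF assms] by (simp add: mult.commute)
qed

lemma L2_w_measure: "L2 (w_measure m R) = L2 (mu m R)"
proof -
  have "borel_measurable (w_measure m R) = borel_measurable (leb_ivl R)"
    by (rule measurable_cong_sets) (simp_all add: w_measure_def)
  then show ?thesis
    unfolding L2_def borel_measurable_mu by (auto simp: integrable_w_measure_iff)
qed

lemma prob_space_mu: "integrable (mu m R) (\<lambda>r. c)" "(\<integral>r. c \<partial>mu m R) = (c :: real)"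
proof -
  have "integrable (leb_ivl R) (w m)" "(\<integral>r. w m r \<partial>leb_ivl R) = W m R"
    using leb_ivl_continuous(1)[OF continuous_on_w[OF mpos']] by (auto simp: W_def)
  then show "integrable (mu m R) (\<lambda>r. c)" "(\<integral>r. c \<partial>mu m R) = c"
    using W_R_pos integral_mu[of "\<lambda>r. c"] integrable_mu_iff[of "\<lambda>r. c"] by (simp_all del: lebesgue_integral_const)
qed

lemma measure_mu_space [simp]: "measure (mu m R) (space (mu m R)) = 1"
  using prob_space_mu(2)[of 1] by simp

lemma L2_bounded:
  assumes "f \<in> borel_measurable (mu m R)" "\<And>r. r \<in> {0<..<R} \<Longrightarrow> \<bar>f r\<bar> \<le> B"
  shows "f \<in> L2 (mu m R)"
proof -
  have "(\<lambda>r. 1) \<in> L2 (mu m R)" using prob_space_mu by (simp add: L2_def)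
  from L2_bounded_mult[OF this assms(1), of B] assms(2) show ?thesis by (simp add: space_mu)
qed

lemma L2_const: "(\<lambda>r. c) \<in> L2 (mu m R)"
  using prob_space_mu by (simp add: L2_def)

lemma L2_integrable: "f \<in> L2 (mu m R) \<Longrightarrow> integrable (mu m R) f"
  using L2_mult_integrable[OF L2_const[of 1]] by simp

lemma L2_mult_radius: "f \<in> L2 (mu m R) \<Longrightarrow> (\<lambda>r. r * f r) \<in> L2 (mu m R)"
  by (rule L2_bounded_mult[where B = R]) (auto intro: measurable_continuous continuous_intros simp: space_mu)

lemma Var_eq:
  assumes "g \<in> L2 (mu m R)"
  shows "Var m R g = (\<integral>r. (g r)\<^sup>2 \<partial>mu m R) - (Expec m R g)\<^sup>2"
proof -
  define e where "e = Expec m R g"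
  have "Var m R g = (\<integral>r. (g r)\<^sup>2 + (- (2 * e)) * g r + e\<^sup>2 \<partial>mu m R)"
    unfolding Var_def e_def[symmetric] by (simp add: Expec_def power2_diff algebra_simps)
  also have "\<dots> = (\<integral>r. (g r)\<^sup>2 \<partial>mu m R) + (- (2 * e)) * (\<integral>r. g r \<partial>mu m R) + e\<^sup>2"
    using L2_power2_integrable[OF assms] L2_integrable[OF assms] prob_space_mu by simp
  also have "(\<integral>r. g r \<partial>mu m R) = e" by (simp add: e_def Expec_def)
  finally show ?thesis by (simp add: e_def power2_eq_square)
qed

lemma H1_facts:
  assumes "v \<in> H1 m R"
  shows "is_weak_deriv R v (wderiv R v)" "v \<in> L2 (mu m R)" "wderiv R v \<in> L2 (mu m R)"
    "T R v \<in> L2 (mu m R)"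
proof -
  obtain u where "is_weak_deriv R v u" using assms by (auto simp: H1_def H1_loc_def)
  then show weak: "is_weak_deriv R v (wderiv R v)" by (rule weak_derivative_wderiv)
  then have meas: "v \<in> borel_measurable (leb_ivl R)" "wderiv R v \<in> borel_measurable (leb_ivl R)"
    using L1_loc_measurable by (auto simp: is_weak_deriv_def)
  have int: "integrable (mu m R) (\<lambda>r. (v r)\<^sup>2 + (wderiv R v r)\<^sup>2)"
    using assms meas by (simp add: H1_def integrable_w_measure_iff)
  show v: "v \<in> L2 (mu m R)"
    unfolding L2_def borel_measurable_mu
    using meas by (auto intro!: Bochner_Integration.integrable_bound[OF int] borel_measurable_power
        simp: borel_measurable_mu)
  show u: "wderiv R v \<in> L2 (mu m R)"
    unfolding L2_def borel_measurable_mu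
    using meas by (auto intro!: Bochner_Integration.integrable_bound[OF int] borel_measurable_power
        simp: borel_measurable_mu)
  show "T R v \<in> L2 (mu m R)"
    unfolding T_def[abs_def] by (intro L2_diff L2_mult_radius v u)
qed

lemma continuous_L2_loc:
  assumes "continuous_on {0<..<R} v" shows "v \<in> L2_loc R"
proof -
  have "v \<in> L1_loc R" "(\<lambda>r. (v r)\<^sup>2) \<in> L1_loc R"
    using assms by (auto intro!: L1_loc_continuous continuous_intros)
  then show ?thesis unfolding L1_loc_def L2_loc_def L2_def by auto
qed

text \<open>Supplies the competitors: for them \<open>wderiv\<close> may be computed classically, up to a null set.\<close>

lemma classical_in_H1:
  assumes v: "\<And>r. r \<in> {0<..<R} \<Longrightarrow> (v has_real_derivative p r) (at r)"
    and p: "continuous_on {0<..<R} p"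
    and bounded: "\<And>r. r \<in> {0<..<R} \<Longrightarrow> \<bar>v r\<bar> \<le> B" "\<And>r. r \<in> {0<..<R} \<Longrightarrow> \<bar>p r\<bar> \<le> B"
  shows "v \<in> H1 m R" "AE r in mu m R. wderiv R v r = p r" "v \<in> L2 (mu m R)" "p \<in> L2 (mu m R)"
proof -
  have vc: "continuous_on {0<..<R} v"
    by (rule DERIV_continuous_on[OF has_field_derivative_at_within[OF v]])
  have weak: "is_weak_deriv R v p" by (rule classical_derivative_is_weak[OF v p R])
  note weak' = weak_derivative_wderiv[OF weak]
  have ae: "AE r in leb_ivl R. wderiv R v r = p r" by (rule weak_derivative_unique[OF weak' weak R])
  then show ae': "AE r in mu m R. wderiv R v r = p r"
    unfolding mu_def by (subst AE_density) (auto elim: eventually_mono)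
  show L2v: "v \<in> L2 (mu m R)" by (rule L2_bounded[OF measurable_continuous[OF vc] bounded(1)])
  show L2p: "p \<in> L2 (mu m R)" by (rule L2_bounded[OF measurable_continuous[OF p] bounded(2)])
  have meas: "v \<in> borel_measurable (leb_ivl R)" "wderiv R v \<in> borel_measurable (leb_ivl R)"
    using L1_loc_measurable weak' by (auto simp: is_weak_deriv_def)
  have "integrable (mu m R) (\<lambda>r. (v r)\<^sup>2 + (p r)\<^sup>2)"
    using L2v L2p by (simp add: L2_def)
  then have "integrable (mu m R) (\<lambda>r. (v r)\<^sup>2 + (wderiv R v r)\<^sup>2)"
  proof (rule integrable_cong_AE_imp)
    show "(\<lambda>r. (v r)\<^sup>2 + (wderiv R v r)\<^sup>2) \<in> borel_measurable (mu m R)"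
      unfolding borel_measurable_mu by (intro borel_measurable_add borel_measurable_power meas)
    show "AE r in mu m R. (v r)\<^sup>2 + (p r)\<^sup>2 = (v r)\<^sup>2 + (wderiv R v r)\<^sup>2"
      using ae' by eventually_elim simp
  qed
  then have "integrable (w_measure m R) (\<lambda>r. (v r)\<^sup>2 + (wderiv R v r)\<^sup>2)"
    using meas by (simp add: integrable_w_measure_iff)
  then show "v \<in> H1 m R"
    unfolding H1_def H1_loc_def using weak continuous_L2_loc[OF vc] continuous_L2_loc[OF p] by auto
qed

lemma H1_zero: "(\<lambda>r. 0) \<in> H1 m R"
  by (rule classical_in_H1(1)[where p = "\<lambda>r. 0" and B = 0]) auto

section \<open>The saddle point\<close>

lemma Phi_eq:
  assumes "g \<in> L2 (mu m R)" "Expec m R g = 1"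
  shows "Phi m R g v = (\<integral>r. (wderiv R v r)\<^sup>2 + (v r)\<^sup>2 + (g r + T R v r)\<^sup>2 / m \<partial>mu m R)
    - (\<integral>r. (g r)\<^sup>2 \<partial>mu m R) + 1"
proof -
  have "Var m R g = (\<integral>r. (g r)\<^sup>2 \<partial>mu m R) - 1"
    using Var_eq[OF assms(1)] assms(2) by simp
  then show ?thesis by (simp only: Phi_def Expec_def)
qed

lemma Phi_bdd_below:
  shows "bdd_below ((\<lambda>v. Phi m R g v) ` H1 m R)"
proof (rule bdd_belowI2)
  fix v
  have "0 \<le> Expec m R (\<lambda>r. (wderiv R v r)\<^sup>2 + (v r)\<^sup>2 + (g r + T R v r)\<^sup>2 / m)"
    unfolding Expec_def using m by (intro Bochner_Integration.integral_nonneg) auto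
  then show "- Var m R g \<le> Phi m R g v" by (simp add: Phi_def)
qed

definition energy where
  "energy v p = (\<integral>r. (p r)\<^sup>2 + (v r)\<^sup>2 + (1 + (r * v r - p r))\<^sup>2 / (m - 1) \<partial>mu m R)"

lemma energy_nonneg: "energy v p \<ge> 0"
  unfolding energy_def using m by (intro Bochner_Integration.integral_nonneg) auto

text \<open>Completing the square in \<open>g\<close>: the defect is \<open>(1 - 1/m)\<close> times the square of
  \<open>g - l (1 + (1 + t) / (m - 1))\<close>. The linear term \<open>2 l g\<close> is the Lagrange term for the constraint
  \<open>E g = 1\<close>.\<close>

lemma complete_square_in_g:
  fixes g l t :: real
  shows "(g + l * t)\<^sup>2 / m - g\<^sup>2 + 2 * l * g \<le> l\<^sup>2 * ((1 + t)\<^sup>2 / (m - 1) + 1)"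
proof -
  have "l\<^sup>2 * ((1 + t)\<^sup>2 / (m - 1) + 1) - ((g + l * t)\<^sup>2 / m - g\<^sup>2 + 2 * l * g)
      = ((m - 1) * g - l * (t + m))\<^sup>2 / (m * (m - 1))"
  proof -
    have "m \<noteq> 0" "m - 1 \<noteq> 0" using m by auto
    then have "m * (m - 1) * (l\<^sup>2 * ((1 + t)\<^sup>2 / (m - 1) + 1) - ((g + l * t)\<^sup>2 / m - g\<^sup>2 + 2 * l * g))
      = m * (l\<^sup>2 * ((1 + t)\<^sup>2 + (m - 1))) - (m - 1) * ((g + l * t)\<^sup>2 + m * (2 * l * g - g\<^sup>2))"
      by (simp add: field_simps)
    also have "\<dots> = ((m - 1) * g - l * (t + m))\<^sup>2"
      by (simp add: power2_eq_square algebra_simps)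
    finally show ?thesis using m by (simp add: eq_divide_eq mult.commute)
  qed
  also have "\<dots> \<ge> 0" using m by simp
  finally show ?thesis by simp
qed

text \<open>After completing the square, the competitor \<open>l v\<close> bounds the functional by \<open>1 - 2 l + l^2 (1 + J)\<close> with
  \<open>J = energy v p\<close>, uniformly in \<open>g\<close>; the choice \<open>l = 1 / (1 + J)\<close> minimizes this bound.\<close>

lemma INF_Phi_le:
  assumes v: "\<And>r. r \<in> {0<..<R} \<Longrightarrow> (v has_real_derivative p r) (at r)"
    and p: "continuous_on {0<..<R} p"
    and bounded: "\<And>r. r \<in> {0<..<R} \<Longrightarrow> \<bar>v r\<bar> \<le> B" "\<And>r. r \<in> {0<..<R} \<Longrightarrow> \<bar>p r\<bar> \<le> B"
    and g: "g \<in> L2 (mu m R)" "Expec m R g = 1"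
  shows "(INF v\<in>H1 m R. Phi m R g v) \<le> energy v p / (1 + energy v p)"
proof -
  define J where "J = energy v p"
  have J: "J \<ge> 0" by (simp add: J_def energy_nonneg)
  define l where "l = 1 / (1 + J)"
  define t where "t r = r * v r - p r" for r
  have H: "(\<lambda>r. l * v r) \<in> H1 m R" "AE r in mu m R. wderiv R (\<lambda>r. l * v r) r = l * p r"
  proof -
    have "\<And>r. r \<in> {0<..<R} \<Longrightarrow> ((\<lambda>r. l * v r) has_real_derivative l * p r) (at r)"
      using v by (auto intro!: derivative_eq_intros)
    moreover have "continuous_on {0<..<R} (\<lambda>r. l * p r)" using p by (auto intro: continuous_intros)
    moreover have "\<bar>l * v r\<bar> \<le> \<bar>l\<bar> * B" "\<bar>l * p r\<bar> \<le> \<bar>l\<bar> * B" if "r \<in> {0<..<R}" for r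
      using bounded[OF that] by (auto simp: abs_mult intro!: mult_left_mono)
    ultimately show "(\<lambda>r. l * v r) \<in> H1 m R" and "AE r in mu m R. wderiv R (\<lambda>r. l * v r) r = l * p r"
      by - (rule classical_in_H1; assumption)+
  qed
  have L2: "v \<in> L2 (mu m R)" "p \<in> L2 (mu m R)"
    using classical_in_H1(3,4)[OF v p bounded] by auto
  then have L2t: "t \<in> L2 (mu m R)" unfolding t_def[abs_def] by (intro L2_diff L2_mult_radius)
  let ?E = "\<lambda>f. \<integral>r. f r \<partial>mu m R"
  have "Phi m R g (\<lambda>r. l * v r)
      = ?E (\<lambda>r. (l * p r)\<^sup>2 + (l * v r)\<^sup>2 + (g r + l * t r)\<^sup>2 / m) - ?E (\<lambda>r. (g r)\<^sup>2) + 1"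
  proof -
    have "?E (\<lambda>r. (wderiv R (\<lambda>r. l * v r) r)\<^sup>2 + (l * v r)\<^sup>2 + (g r + T R (\<lambda>r. l * v r) r)\<^sup>2 / m)
        = ?E (\<lambda>r. (l * p r)\<^sup>2 + (l * v r)\<^sup>2 + (g r + l * t r)\<^sup>2 / m)"
    proof (rule integral_cong_AE)
      show "AE r in mu m R. (wderiv R (\<lambda>r. l * v r) r)\<^sup>2 + (l * v r)\<^sup>2 + (g r + T R (\<lambda>r. l * v r) r)\<^sup>2 / m
          = (l * p r)\<^sup>2 + (l * v r)\<^sup>2 + (g r + l * t r)\<^sup>2 / m"
        using H(2) by eventually_elim (simp add: T_def t_def algebra_simps)
    qed (use L2_measurable[OF g(1)] L2_measurable[OF L2(1)] L2_measurable[OF L2(2)] L2_measurable[OF L2t]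
          L2_measurable[OF H1_facts(3)[OF H(1)]] L2_measurable[OF H1_facts(4)[OF H(1)]] in measurable)
    then show ?thesis unfolding Phi_eq[OF g] by simp
  qed
  also have "\<dots> = ?E (\<lambda>r. (l * p r)\<^sup>2 + (l * v r)\<^sup>2 + ((g r + l * t r)\<^sup>2 / m - (g r)\<^sup>2 + 2 * l * g r)) - 2 * l + 1"
  proof -
    have i1: "integrable (mu m R) (\<lambda>r. (l * p r)\<^sup>2 + (l * v r)\<^sup>2 + (g r + l * t r)\<^sup>2 / m)"
      by (intro Bochner_Integration.integrable_add Bochner_Integration.integrable_divide_zero L2_power2_integrable L2_add L2_cmult g L2 L2t)
    have "?E (\<lambda>r. ((l * p r)\<^sup>2 + (l * v r)\<^sup>2 + (g r + l * t r)\<^sup>2 / m) - (g r)\<^sup>2 + 2 * l * g r)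
       = ?E (\<lambda>r. (l * p r)\<^sup>2 + (l * v r)\<^sup>2 + (g r + l * t r)\<^sup>2 / m) - ?E (\<lambda>r. (g r)\<^sup>2) + 2 * l * ?E g"
      using i1 L2_power2_integrable[OF g(1)] L2_integrable[OF g(1)] by simp
    moreover have "?E g = 1" using g(2) by (simp add: Expec_def)
    ultimately show ?thesis by (simp add: algebra_simps)
  qed
  finally have "Phi m R g (\<lambda>r. l * v r) = ?E (\<lambda>r. (l * p r)\<^sup>2 + (l * v r)\<^sup>2
      + ((g r + l * t r)\<^sup>2 / m - (g r)\<^sup>2 + 2 * l * g r)) - 2 * l + 1" .
  moreover have "?E (\<lambda>r. (l * p r)\<^sup>2 + (l * v r)\<^sup>2 + ((g r + l * t r)\<^sup>2 / m - (g r)\<^sup>2 + 2 * l * g r))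
      \<le> ?E (\<lambda>r. l\<^sup>2 * ((p r)\<^sup>2 + (v r)\<^sup>2 + (1 + t r)\<^sup>2 / (m - 1) + 1))"
  proof (rule integral_mono)
    show "integrable (mu m R) (\<lambda>r. (l * p r)\<^sup>2 + (l * v r)\<^sup>2 + ((g r + l * t r)\<^sup>2 / m - (g r)\<^sup>2 + 2 * l * g r))"
      by (intro Bochner_Integration.integrable_add Bochner_Integration.integrable_diff Bochner_Integration.integrable_divide_zero
          Bochner_Integration.integrable_mult_right L2_power2_integrable L2_integrable L2_add L2_cmult g L2 L2t)
    show "integrable (mu m R) (\<lambda>r. l\<^sup>2 * ((p r)\<^sup>2 + (v r)\<^sup>2 + (1 + t r)\<^sup>2 / (m - 1) + 1))"
      by (intro Bochner_Integration.integrable_add Bochner_Integration.integrable_divide_zero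
          Bochner_Integration.integrable_mult_right L2_power2_integrable L2_add L2_const prob_space_mu L2 L2t)
    show "(l * p r)\<^sup>2 + (l * v r)\<^sup>2 + ((g r + l * t r)\<^sup>2 / m - (g r)\<^sup>2 + 2 * l * g r)
        \<le> l\<^sup>2 * ((p r)\<^sup>2 + (v r)\<^sup>2 + (1 + t r)\<^sup>2 / (m - 1) + 1)" for r
      using complete_square_in_g[of "g r" l "t r"] unfolding power_mult_distrib distrib_left by linarith
  qed
  moreover have "?E (\<lambda>r. l\<^sup>2 * ((p r)\<^sup>2 + (v r)\<^sup>2 + (1 + t r)\<^sup>2 / (m - 1) + 1)) = l\<^sup>2 * (J + 1)"
  proof -
    have "integrable (mu m R) (\<lambda>r. (p r)\<^sup>2 + (v r)\<^sup>2 + (1 + t r)\<^sup>2 / (m - 1))"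
      by (intro Bochner_Integration.integrable_add Bochner_Integration.integrable_divide_zero
          L2_power2_integrable L2_add L2_const L2 L2t)
    then have "?E (\<lambda>r. (p r)\<^sup>2 + (v r)\<^sup>2 + (1 + t r)\<^sup>2 / (m - 1) + 1) = J + 1"
      by (subst Bochner_Integration.integral_add) (auto simp: prob_space_mu J_def energy_def t_def)
    then show ?thesis by simp
  qed
  moreover have "l\<^sup>2 * (J + 1) - 2 * l + 1 = J / (1 + J)"
  proof -
    have l: "l * (J + 1) = 1" using J by (simp add: l_def)
    have "l\<^sup>2 * (J + 1) = l * (l * (J + 1))" by (simp only: power2_eq_square mult.assoc)
    moreover have "J / (1 + J) = 1 - l" using J by (simp add: l_def field_simps)
    ultimately show ?thesis unfolding l by simp
  qed
  ultimately have "Phi m R g (\<lambda>r. l * v r) \<le> J / (1 + J)" by linarith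
  moreover have "(INF v\<in>H1 m R. Phi m R g v) \<le> Phi m R g (\<lambda>r. l * v r)"
    by (rule cINF_lower[OF Phi_bdd_below H(1)])
  ultimately show ?thesis by (simp add: J_def)
qed

abbreviation "sR \<equiv> multiplier m (free_const m R)"
abbreviation "vR \<equiv> extremal m (free_const m R)"
abbreviation "pR \<equiv> extremal' m (free_const m R)"

lemma extremal_continuous: "continuous_on {0<..<R} sR" "continuous_on {0<..<R} vR" "continuous_on {0<..<R} pR"
proof -
  show 1: "continuous_on {0<..<R} sR"
    by (rule DERIV_continuous_on[OF has_field_derivative_at_within[OF multiplier_deriv[OF m]]]) auto
  show 2: "continuous_on {0<..<R} vR"
    unfolding extremal_def[abs_def] by (intro continuous_intros 1)
  show "continuous_on {0<..<R} pR"
    unfolding extremal'_def[abs_def] by (intro continuous_intros 1 2)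
qed

lemma extremal_bounded: "\<exists>B. \<forall>r\<in>{0<..<R}. \<bar>sR r\<bar> \<le> B \<and> \<bar>vR r\<bar> \<le> B \<and> \<bar>pR r\<bar> \<le> B"
  by (rule multiplier_bounded[OF m, of R "free_const m R"]) blast

lemma extremal_L2: "sR \<in> L2 (mu m R)" "vR \<in> L2 (mu m R)" "pR \<in> L2 (mu m R)"
proof -
  obtain B where B: "\<forall>r\<in>{0<..<R}. \<bar>sR r\<bar> \<le> B \<and> \<bar>vR r\<bar> \<le> B \<and> \<bar>pR r\<bar> \<le> B"
    using extremal_bounded by blast
  show "sR \<in> L2 (mu m R)"
    by (rule L2_bounded[OF measurable_continuous[OF extremal_continuous(1)], of B]) (use B in blast)
  show "vR \<in> L2 (mu m R)"
    by (rule L2_bounded[OF measurable_continuous[OF extremal_continuous(2)], of B]) (use B in blast)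
  show "pR \<in> L2 (mu m R)"
    by (rule L2_bounded[OF measurable_continuous[OF extremal_continuous(3)], of B]) (use B in blast)
qed

text \<open>Since \<open>s T v = s (r v - v')\<close>, the integrand times the weight is the flux times \<open>v'\<close> plus the derivative of the
  flux times \<open>v\<close>, and integration by parts applies.\<close>

lemma euler_lagrange:
  assumes "v \<in> H1 m R"
  shows "(\<integral>r. pR r * wderiv R v r + vR r * v r + sR r * T R v r \<partial>mu m R) = 0"
proof -
  note v = H1_facts[OF assms]
  let ?F = "\<lambda>r. fluxY m r - free_const m R * fluxZ m r"
  let ?f = "\<lambda>r. 2 * r * W (m - 1) r - free_const m R * (2 * r * W m r + w m r)"
  obtain B where B: "\<And>r. r \<in> {0<..<R} \<Longrightarrow> \<bar>?F r\<bar> \<le> r * (B * w m r)"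
    "\<And>r. r \<in> {0<..<R} \<Longrightarrow> \<bar>?F r\<bar> \<le> (R - r) * (B * w m r)"
    using flux_bounds[OF m R] by metis
  have sp: "space (leb_ivl R) = {0<..<R}" by (simp add: space_restrict_space)
  have weighted: "integrable (leb_ivl R) (\<lambda>r. f r * w m r)" if "integrable (mu m R) f" for f
    using that integrable_mu_iff[of f] borel_measurable_integrable[OF that] by (simp add: borel_measurable_mu)
  have 1: "integrable (mu m R) (\<lambda>r. v r * (vR r + r * sR r))" "integrable (mu m R) (\<lambda>r. wderiv R v r * (pR r - sR r))"
    by (intro L2_mult_integrable L2_add L2_diff L2_mult_radius v extremal_L2)+
  have vf: "v r * (vR r + r * sR r) * w m r = v r * ?f r"
    and uF: "wderiv R v r * (pR r - sR r) * w m r = wderiv R v r * ?F r" if "r \<in> {0<..<R}" for r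
    using that flux'_eq[OF m, of r "free_const m R"] flux_eq[OF m, of r "free_const m R"] by (simp_all add: mult.assoc)
  have int: "integrable (leb_ivl R) (\<lambda>r. v r * ?f r)" "integrable (leb_ivl R) (\<lambda>r. wderiv R v r * ?F r)"
  proof -
    have "integrable (leb_ivl R) (\<lambda>r. v r * (vR r + r * sR r) * w m r) \<longleftrightarrow> integrable (leb_ivl R) (\<lambda>r. v r * ?f r)"
      by (rule Bochner_Integration.integrable_cong) (simp_all only: sp vf)
    then show "integrable (leb_ivl R) (\<lambda>r. v r * ?f r)" using weighted[OF 1(1)] by blast
    have "integrable (leb_ivl R) (\<lambda>r. wderiv R v r * (pR r - sR r) * w m r)
        \<longleftrightarrow> integrable (leb_ivl R) (\<lambda>r. wderiv R v r * ?F r)"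
      by (rule Bochner_Integration.integrable_cong) (simp_all only: sp uF)
    then show "integrable (leb_ivl R) (\<lambda>r. wderiv R v r * ?F r)" using weighted[OF 1(2)] by blast
  qed
  have "(\<integral>r. v r * ?f r + wderiv R v r * ?F r \<partial>leb_ivl R) = 0"
  proof (rule weak_integration_by_parts[OF R v(1), where \<rho> = "\<lambda>r. B * w m r"])
    show "diffs_on n {0<..<R} ?F" for n by (rule diffs_on_flux[OF m])
    show "(?F has_real_derivative ?f r) (at r)" if "r \<in> {0<..<R}" for r
      using that by (auto intro!: derivative_eq_intros fluxY_deriv[OF m] fluxZ_deriv[OF m])
    have "continuous_on {0..R} ?f"
      using m by (intro continuous_intros continuous_on_W continuous_on_w) auto
    then show "continuous_on {0<..<R} ?f" by (rule continuous_on_subset) auto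
    have "integrable (leb_ivl R) (\<lambda>r. B * (v r * w m r))" using weighted[OF L2_integrable[OF v(2)]] by simp
    then show "integrable (leb_ivl R) (\<lambda>r. v r * (B * w m r))" by (simp add: mult_ac)
  qed (use B int in auto)
  also have "(\<integral>r. v r * ?f r + wderiv R v r * ?F r \<partial>leb_ivl R)
      = (\<integral>r. (pR r * wderiv R v r + vR r * v r + sR r * T R v r) * w m r \<partial>leb_ivl R)"
  proof (intro Bochner_Integration.integral_cong refl)
    fix r assume "r \<in> space (leb_ivl R)"
    then have "r \<in> {0<..<R}" by (simp add: sp)
    from vf[OF this] uF[OF this] show "v r * ?f r + wderiv R v r * ?F r
        = (pR r * wderiv R v r + vR r * v r + sR r * T R v r) * w m r"
      unfolding T_def by algebra
  qed
  finally have zero: "(\<integral>r. (pR r * wderiv R v r + vR r * v r + sR r * T R v r) * w m r \<partial>leb_ivl R) = 0" .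
  have "(\<lambda>r. pR r * wderiv R v r + vR r * v r + sR r * T R v r) \<in> borel_measurable (leb_ivl R)"
    unfolding borel_measurable_mu[symmetric]
    by (intro borel_measurable_add borel_measurable_times extremal_L2[THEN L2_measurable] v(2-4)[THEN L2_measurable])
  from integral_mu[OF this] zero show ?thesis by simp
qed

lemma extremal_in_H1: "vR \<in> H1 m R" "AE r in mu m R. wderiv R vR r = pR r"
  and INF_Phi_le_extremal: "g \<in> L2 (mu m R) \<Longrightarrow> Expec m R g = 1 \<Longrightarrow>
    (INF v\<in>H1 m R. Phi m R g v) \<le> energy vR pR / (1 + energy vR pR)"
proof -
  obtain B where "\<forall>r\<in>{0<..<R}. \<bar>sR r\<bar> \<le> B \<and> \<bar>vR r\<bar> \<le> B \<and> \<bar>pR r\<bar> \<le> B"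
    using extremal_bounded by blast
  then have B: "\<And>r. r \<in> {0<..<R} \<Longrightarrow> \<bar>vR r\<bar> \<le> B" "\<And>r. r \<in> {0<..<R} \<Longrightarrow> \<bar>pR r\<bar> \<le> B"
    by blast+
  have d: "\<And>r. r \<in> {0<..<R} \<Longrightarrow> (vR has_real_derivative pR r) (at r)" using extremal_deriv[OF m] by simp
  show "vR \<in> H1 m R" "AE r in mu m R. wderiv R vR r = pR r"
    using classical_in_H1[OF d extremal_continuous(3) B] by auto
  show "g \<in> L2 (mu m R) \<Longrightarrow> Expec m R g = 1 \<Longrightarrow>
    (INF v\<in>H1 m R. Phi m R g v) \<le> energy vR pR / (1 + energy vR pR)"
    by (rule INF_Phi_le[OF d extremal_continuous(3) B])
qed

lemma extremal_relation: "pR r - r * vR r + (m - 1) * sR r = 1"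
  by (simp add: extremal'_def)

lemma multiplier_mean: "(\<integral>r. sR r \<partial>mu m R) = min_value m R"
  using L2_measurable[OF extremal_L2(1)]
  by (subst integral_mu) (auto simp: borel_measurable_mu multiplier_integral[OF m R] min_value_def)

text \<open>The minimizer tested against itself: by \<open>extremal_relation\<close> the Euler equation gives that the
  integrals of \<open>v'^2 + v^2 + (m - 1) s^2\<close> and of \<open>s\<close> agree.\<close>

lemma energy_mean: "(\<integral>r. (pR r)\<^sup>2 + (vR r)\<^sup>2 + (m - 1) * (sR r)\<^sup>2 \<partial>mu m R) = min_value m R"
proof -
  have "(\<integral>r. pR r * wderiv R vR r + vR r * vR r + sR r * T R vR r \<partial>mu m R)
      = (\<integral>r. (pR r)\<^sup>2 + (vR r)\<^sup>2 + (m - 1) * (sR r)\<^sup>2 - sR r \<partial>mu m R)"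
  proof (rule integral_cong_AE)
    show "AE r in mu m R. pR r * wderiv R vR r + vR r * vR r + sR r * T R vR r
        = (pR r)\<^sup>2 + (vR r)\<^sup>2 + (m - 1) * (sR r)\<^sup>2 - sR r"
      using extremal_in_H1(2)
    proof eventually_elim
      case (elim r)
      have "r * vR r - pR r = (m - 1) * sR r - 1" using extremal_relation[of r] by simp
      then show ?case unfolding T_def elim by (simp only:) (simp add: power2_eq_square algebra_simps)
    qed
  qed (use extremal_L2[THEN L2_measurable] H1_facts(3,4)[OF extremal_in_H1(1), THEN L2_measurable] in measurable)
  then have "0 = (\<integral>r. (pR r)\<^sup>2 + (vR r)\<^sup>2 + (m - 1) * (sR r)\<^sup>2 - sR r \<partial>mu m R)"
    using euler_lagrange[OF extremal_in_H1(1)] by simp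
  also have "\<dots> = (\<integral>r. (pR r)\<^sup>2 + (vR r)\<^sup>2 + (m - 1) * (sR r)\<^sup>2 \<partial>mu m R) - min_value m R"
    unfolding multiplier_mean[symmetric]
    by (intro Bochner_Integration.integral_diff Bochner_Integration.integrable_add
        Bochner_Integration.integrable_mult_right L2_power2_integrable L2_integrable extremal_L2)
  finally show ?thesis by simp
qed

lemma energy_extremal: "energy vR pR = min_value m R"
proof -
  have "energy vR pR = (\<integral>r. (pR r)\<^sup>2 + (vR r)\<^sup>2 + (m - 1) * (sR r)\<^sup>2 \<partial>mu m R)"
    unfolding energy_def
  proof (intro Bochner_Integration.integral_cong refl)
    fix r
    have "1 + (r * vR r - pR r) = (m - 1) * sR r" using extremal_relation[of r] by simp
    then show "(pR r)\<^sup>2 + (vR r)\<^sup>2 + (1 + (r * vR r - pR r))\<^sup>2 / (m - 1) = (pR r)\<^sup>2 + (vR r)\<^sup>2 + (m - 1) * (sR r)\<^sup>2"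
      using m by (simp add: power2_eq_square)
  qed
  then show ?thesis using energy_mean by simp
qed

lemma min_value_nonneg: "min_value m R \<ge> 0"
  using energy_nonneg[of vR pR] energy_extremal by simp

text \<open>The function \<open>1 + s\<close> maximizes the square completed above for \<open>l = 1\<close> and \<open>t = T v\<close>, since
  \<open>(1 + T v) / (m - 1) = s\<close>; dividing by its mean enforces the constraint. Every square in \<open>v\<close> is
  replaced by its tangent at the minimizer, after which the terms linear in \<open>v\<close> integrate to
  \<open>0\<close> by the Euler equation.\<close>

lemma Phi_ge_extremal:
  defines "g \<equiv> \<lambda>r. (1 + sR r) / (1 + min_value m R)"
  shows "g \<in> L2 (mu m R)" "Expec m R g = 1" "v \<in> H1 m R \<Longrightarrow> min_value m R / (1 + min_value m R) \<le> Phi m R g v"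
proof -
  define l where "l = 1 / (1 + min_value m R)"
  have geq: "g r = l * (1 + sR r)" for r by (simp add: g_def l_def)
  let ?E = "\<lambda>f. \<integral>r. f r \<partial>mu m R"
  have l: "l * (1 + min_value m R) = 1" using min_value_nonneg by (simp add: l_def)
  have g: "g \<in> L2 (mu m R)" unfolding geq[abs_def] by (intro L2_cmult L2_add L2_const extremal_L2)
  then show "g \<in> L2 (mu m R)" .
  have "?E g = l * ?E (\<lambda>r. 1 + sR r)" unfolding geq by simp
  also have "?E (\<lambda>r. 1 + sR r) = 1 + min_value m R"
    using prob_space_mu L2_integrable[OF extremal_L2(1)] multiplier_mean by simp
  finally have g1: "Expec m R g = 1" using l by (simp add: Expec_def)
  then show "Expec m R g = 1" .
  assume "v \<in> H1 m R"
  note v = H1_facts[OF this]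
  have iA: "integrable (mu m R) (\<lambda>r. pR r * wderiv R v r + vR r * v r + sR r * T R v r)"
    by (intro Bochner_Integration.integrable_add L2_mult_integrable extremal_L2 v)
  have iB: "integrable (mu m R) (\<lambda>r. (pR r)\<^sup>2 + (vR r)\<^sup>2 + (m - 1) * (sR r)\<^sup>2)"
    by (intro Bochner_Integration.integrable_add Bochner_Integration.integrable_mult_right L2_power2_integrable extremal_L2)
  have iC: "integrable (mu m R) (\<lambda>r. (wderiv R v r)\<^sup>2 + (v r)\<^sup>2 + (g r + T R v r)\<^sup>2 / m)"
    by (intro Bochner_Integration.integrable_add Bochner_Integration.integrable_divide_zero L2_power2_integrable L2_add v g)
  have pw: "2 * l * (pR r * wderiv R v r + vR r * v r + sR r * T R v r)
      - l\<^sup>2 * ((pR r)\<^sup>2 + (vR r)\<^sup>2 + (m - 1) * (sR r)\<^sup>2) - l\<^sup>2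
      \<le> (wderiv R v r)\<^sup>2 + (v r)\<^sup>2 + (g r + T R v r)\<^sup>2 / m - (g r)\<^sup>2" for r
  proof -
    have tangent: "2 * a * b - a\<^sup>2 \<le> b\<^sup>2" for a b :: real
      using sum_squares_bound[of a b] by simp
    have "2 * (l * sR r) * (g r + T R v r) - m * (l * sR r)\<^sup>2 \<le> (g r + T R v r)\<^sup>2 / m"
      using tangent[of "m * (l * sR r)" "g r + T R v r"] m
      by (simp add: pos_le_divide_eq) (simp add: power2_eq_square algebra_simps)
    moreover note tangent[of "l * pR r" "wderiv R v r"] tangent[of "l * vR r" "v r"]
    ultimately have "2 * (l * pR r) * wderiv R v r - (l * pR r)\<^sup>2 + (2 * (l * vR r) * v r - (l * vR r)\<^sup>2)
        + (2 * (l * sR r) * (g r + T R v r) - m * (l * sR r)\<^sup>2) - (g r)\<^sup>2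
      \<le> (wderiv R v r)\<^sup>2 + (v r)\<^sup>2 + (g r + T R v r)\<^sup>2 / m - (g r)\<^sup>2" by linarith
    then show ?thesis unfolding geq by (simp add: power2_eq_square algebra_simps)
  qed
  have "1 - l\<^sup>2 * (1 + min_value m R) = 2 * l * ?E (\<lambda>r. pR r * wderiv R v r + vR r * v r + sR r * T R v r)
      - l\<^sup>2 * ?E (\<lambda>r. (pR r)\<^sup>2 + (vR r)\<^sup>2 + (m - 1) * (sR r)\<^sup>2) - l\<^sup>2 + 1"
    unfolding euler_lagrange[OF \<open>v \<in> H1 m R\<close>] energy_mean by (simp add: algebra_simps)
  also have "\<dots> = ?E (\<lambda>r. 2 * l * (pR r * wderiv R v r + vR r * v r + sR r * T R v r)
      - l\<^sup>2 * ((pR r)\<^sup>2 + (vR r)\<^sup>2 + (m - 1) * (sR r)\<^sup>2) - l\<^sup>2) + 1"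
    using iA iB prob_space_mu by (simp del: Bochner_Integration.integral_mult_right_zero add: Bochner_Integration.integral_mult_right)
  also have "\<dots> \<le> ?E (\<lambda>r. (wderiv R v r)\<^sup>2 + (v r)\<^sup>2 + (g r + T R v r)\<^sup>2 / m - (g r)\<^sup>2) + 1"
    using iA iB iC prob_space_mu L2_power2_integrable[OF g]
    by (intro add_right_mono integral_mono pw Bochner_Integration.integrable_diff Bochner_Integration.integrable_mult_right)
  also have "\<dots> = Phi m R g v"
    unfolding Phi_eq[OF g g1] using iC L2_power2_integrable[OF g] by simp
  finally have "1 - l\<^sup>2 * (1 + min_value m R) \<le> Phi m R g v" .
  moreover have "1 - l\<^sup>2 * (1 + min_value m R) = min_value m R / (1 + min_value m R)"
  proof -
    have "l\<^sup>2 * (1 + min_value m R) = l * (l * (1 + min_value m R))" by (simp only: power2_eq_square mult.assoc)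
    moreover have "min_value m R / (1 + min_value m R) = 1 - l" using min_value_nonneg by (simp add: l_def field_simps)
    ultimately show ?thesis unfolding l by simp
  qed
  ultimately show "min_value m R / (1 + min_value m R) \<le> Phi m R g v" by simp
qed

lemma lam_eq: "lam m R = min_value m R / (1 + min_value m R)"
proof -
  let ?G = "{g \<in> L2 (w_measure m R). Expec m R g = 1}"
  let ?h = "\<lambda>g. INF v\<in>H1 m R. Phi m R g v"
  let ?g = "\<lambda>r. (1 + sR r) / (1 + min_value m R)"
  have G: "?g \<in> ?G" using Phi_ge_extremal(1,2) by (simp add: L2_w_measure)
  have upper: "?h g \<le> min_value m R / (1 + min_value m R)" if "g \<in> ?G" for g
    using INF_Phi_le_extremal[of g] that by (simp add: L2_w_measure energy_extremal)
  show ?thesis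
  proof (rule antisym)
    show "lam m R \<le> min_value m R / (1 + min_value m R)"
      unfolding lam_def using G upper by (intro cSUP_least) auto
    have "min_value m R / (1 + min_value m R) \<le> ?h ?g"
      using H1_zero Phi_ge_extremal(3) by (intro cINF_greatest) auto
    also have "\<dots> \<le> lam m R"
      unfolding lam_def using G upper by (intro cSUP_upper2[where x = ?g] bdd_aboveI2) auto
    finally show "min_value m R / (1 + min_value m R) \<le> lam m R" .
  qed
qed

end

theorem lemma5p5:
  fixes m :: real
  assumes "m > 1"
  shows "antimono_on {0<..} (\<lambda>R::real. lam m R)"
proof (rule monotone_onI)
  fix R1 R2 :: real assume R: "R1 \<in> {0<..}" "R2 \<in> {0<..}" "R1 \<le> R2"
  let ?N = "min_value m"
  have "?N R2 \<le> ?N R1" using min_value_antimono[OF assms] R by simp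
  moreover have "?N R2 \<ge> 0" using min_value_nonneg[OF assms] R by simp
  ultimately have "?N R2 / (1 + ?N R2) \<le> ?N R1 / (1 + ?N R1)"
    by (simp add: field_simps)
  then show "lam m R1 \<ge> lam m R2" using lam_eq[OF assms] R by simp
qed

end
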